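(* Let $\Delta,m \in \mathbb{Z}_{>0}$. (i) If $m \geq 5$, then \[ h(\Delta,m) \leq m^2 + m + 1 + 2\,(\Delta - 1) \cdot \sum_{i=0}^4 \binom{m}{i}, \] so in particular $h(\Delta,m) \in \mathcal{O}(m^4)\cdot \Delta$. (ii) If $m \geq 4$ and $\Delta$ is odd, then \[ h(\Delta,m) \leq m^2 + m + 1 + 2\,(\Delta - 1) \cdot \sum_{i=0}^3 \binom{m}{i}, \] so in particular $h(\Delta,m) \in \mathcal{O}(m^3)\cdot \Delta$ for odd $\Delta$.
   Context: For a real matrix $A \in \mathbb{R}^{m\times n}$ and $1 \le k \le \min\{m,n\}$, let $\Delta_k(A)$ denote the maximum of $|\det(B)|$ over all $k\times k$ submatrices $B$ of $A$. The generalized Heller constant $h(\Delta,m)$ is the maximum $n \in \mathbb{Z}_{>0}$ such that there exists an integer matrix $A \in \mathbb{Z}^{m\times n}$ with pairwise distinct columns and $\Delta_m(A) = \Delta$ (so $A$ has rank $m$). *)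

theory Defs
  imports "Jordan_Normal_Form.Determinant" "Jordan_Normal_Form.DL_Submatrix"
begin

definition Delta :: "nat \<Rightarrow> 'a::linordered_idom mat \<Rightarrow> 'a" where
  "Delta k A = Max { \<bar>det (submatrix A I J)\<bar> | I J.
      I \<subseteq> {..<dim_row A} \<and> J \<subseteq> {..<dim_col A} \<and> card I = k \<and> card J = k }"

definition heller_set :: "int \<Rightarrow> nat \<Rightarrow> nat set" where
  "heller_set D m = { n. n > 0 \<and> (\<exists>A :: int mat. A \<in> carrier_mat m n \<and>
       distinct (cols A) \<and> Delta m A = D) }"

definition heller :: "int \<Rightarrow> nat \<Rightarrow> nat" where
  "heller D m = Max (heller_set D m)"

end

theory Submission
  imports Defs
begin

text \<open>
  Fix a square submatrix \<open>B\<close> of \<open>A\<close> with \<open>\<bar>det B\<bar> = \<Delta>\<close>. In the basis \<open>B\<close>, the columns of \<open>A\<close>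
  become vectors \<open>y\<close> all of whose minors, of every size, are at most 1 in absolute value. The
  columns fall into at most \<open>\<Delta>\<close> classes modulo the lattice spanned by \<open>B\<close>, and within a class
  the coordinates of \<open>y\<close> are \<open>t r\<close> or \<open>t r - 1\<close> (if \<open>0 < t r < 1\<close>), or \<open>-1, 0, 1\<close> (if
  \<open>t r = 0\<close>). Recording only the parities of the integer parts loses at most a factor 2, so the
  Sauer--Shelah lemma bounds the size of a class once the parity patterns do not shatter large
  sets of rows. Shattered sets force large minors: three rows with \<open>t = 0\<close> give a Fano plane;
  two such rows and two fractional ones give a minor above 1; four fractional rows give a minor
  \<open>2 t r\<close> or \<open>2 (1 - t r)\<close>, so \<open>t r = 1/2\<close>, and adding a fifth row of either kind borders a
  Hadamard matrix of order 4 to a \<open>5 \<times> 5\<close> minor above 1. For odd \<open>\<Delta>\<close> the value \<open>1/2\<close> does not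
  occur, and four rows suffice. The class of 0 contributes Heller's bound \<open>m\<^sup>2 + m + 1\<close>.
\<close>

section \<open>The Sauer--Shelah lemma\<close>

definition shatters :: "'a set set \<Rightarrow> 'a set \<Rightarrow> bool" where
  "shatters F I \<longleftrightarrow> (\<forall>S\<subseteq>I. \<exists>X\<in>F. X \<inter> I = S)"

lemma shatters_mono: "shatters F I \<Longrightarrow> F \<subseteq> G \<Longrightarrow> shatters G I"
  unfolding shatters_def by (meson subsetD)

lemma shatters_subset:
  assumes "shatters F I" "J \<subseteq> I"
  shows "shatters F J"
  unfolding shatters_def
proof (intro allI impI)
  fix S assume "S \<subseteq> J"
  with assms obtain X where "X \<in> F" "X \<inter> I = S"
    unfolding shatters_def by (meson subset_trans)
  with \<open>S \<subseteq> J\<close> \<open>J \<subseteq> I\<close> show "\<exists>X\<in>F. X \<inter> J = S" by blast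
qed

text \<open>Pajor's form of the Sauer--Shelah lemma: it is stronger than the binomial bound, and
  the induction on the ground set goes through without arithmetic.\<close>

lemma card_le_card_shattered:
  assumes "finite S" "F \<subseteq> Pow S"
  shows "card F \<le> card {I. I \<subseteq> S \<and> shatters F I}"
  using assms
proof (induction S arbitrary: F rule: finite_induct)
  case empty
  then consider "F = {}" | "F = {{}}" by fastforce
  then show ?case
  proof cases
    case 2
    have "{I::'a set. I \<subseteq> {} \<and> shatters {{}} I} = {{}}"
      by (auto simp: shatters_def)
    with 2 show ?thesis by simp
  qed simp
next
  case (insert a S)
  \<comment> \<open>Split by membership of \<open>a\<close>. A set \<open>I\<close> shattered by
    both \<open>F0\<close> and \<open>F1\<close> is counted twice on the left and pays twice on the
    right, since \<open>F\<close> then shatters \<open>I\<close> and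
    \<open>insert a I\<close>.\<close>
  define F0 where "F0 = {X\<in>F. a \<notin> X}"
  define F1 where "F1 = (\<lambda>X. X - {a}) ` {X\<in>F. a \<in> X}"
  define Sh where "Sh G = {I. I \<subseteq> S \<and> shatters G I}" for G
  have fin: "finite (Sh G)" for G
    unfolding Sh_def by (rule finite_subset[of _ "Pow S"]) (use insert.hyps in auto)
  have finF: "finite F"
    using insert.prems insert.hyps by (meson finite_Pow_iff finite_insert finite_subset)
  have "inj_on (\<lambda>X. X - {a}) {X\<in>F. a \<in> X}" by (auto simp: inj_on_def)
  then have "card F1 = card {X\<in>F. a \<in> X}" unfolding F1_def by (rule card_image)
  moreover have "F = F0 \<union> {X\<in>F. a \<in> X}" "F0 \<inter> {X\<in>F. a \<in> X} = {}"
    unfolding F0_def by auto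
  ultimately have cF: "card F = card F0 + card F1"
    using finF card_Un_disjoint[of F0 "{X\<in>F. a \<in> X}"] by (simp add: F0_def)
  have "F0 \<subseteq> Pow S" "F1 \<subseteq> Pow S"
    using insert.prems by (auto simp: F0_def F1_def)
  then have le: "card F0 \<le> card (Sh F0)" "card F1 \<le> card (Sh F1)"
    unfolding Sh_def using insert.IH by auto
  have sub: "Sh F0 \<union> Sh F1 \<union> Set.insert a ` (Sh F0 \<inter> Sh F1) \<subseteq> {I. I \<subseteq> insert a S \<and> shatters F I}"
  proof (intro Un_least)
    show "Sh F0 \<subseteq> {I. I \<subseteq> insert a S \<and> shatters F I}"
      unfolding Sh_def F0_def using shatters_mono[of "{X\<in>F. a \<notin> X}" _ F] by auto
    show "Sh F1 \<subseteq> {I. I \<subseteq> insert a S \<and> shatters F I}"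
    proof
      fix I assume I: "I \<in> Sh F1"
      have "shatters F I"
        unfolding shatters_def
      proof (intro allI impI)
        fix T assume "T \<subseteq> I"
        then obtain Y where "Y \<in> F1" "Y \<inter> I = T"
          using I unfolding Sh_def shatters_def by blast
        then obtain X where "X \<in> F" "a \<in> X" "(X - {a}) \<inter> I = T"
          unfolding F1_def by blast
        moreover have "a \<notin> I" using I insert.hyps by (auto simp: Sh_def)
        ultimately show "\<exists>X\<in>F. X \<inter> I = T" by blast
      qed
      with I show "I \<in> {I. I \<subseteq> insert a S \<and> shatters F I}" by (auto simp: Sh_def)
    qed
    show "Set.insert a ` (Sh F0 \<inter> Sh F1) \<subseteq> {I. I \<subseteq> insert a S \<and> shatters F I}"
    proof
      fix J assume "J \<in> Set.insert a ` (Sh F0 \<inter> Sh F1)"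
      then obtain I where J: "J = Set.insert a I" and I: "I \<in> Sh F0" "I \<in> Sh F1" by auto
      have aI: "a \<notin> I" using I insert.hyps by (auto simp: Sh_def)
      have "shatters F J"
        unfolding shatters_def
      proof (intro allI impI)
        fix T assume T: "T \<subseteq> J"
        show "\<exists>X\<in>F. X \<inter> J = T"
        proof (cases "a \<in> T")
          case True
          have "T - {a} \<subseteq> I" using T J by auto
          then obtain Y where "Y \<in> F1" "Y \<inter> I = T - {a}"
            using I(2) unfolding Sh_def shatters_def by blast
          then obtain X where "X \<in> F" "a \<in> X" "(X - {a}) \<inter> I = T - {a}"
            unfolding F1_def by blast
          with aI J True show ?thesis by (intro bexI[of _ X]) blast+
        next
          case False
          then have "T \<subseteq> I" using T J by auto
          then obtain X where "X \<in> F0" "X \<inter> I = T"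
            using I(1) unfolding Sh_def shatters_def by blast
          with J show ?thesis unfolding F0_def by (intro bexI[of _ X]) blast+
        qed
      qed
      with I J show "J \<in> {I. I \<subseteq> insert a S \<and> shatters F I}" by (auto simp: Sh_def)
    qed
  qed
  have "inj_on (Set.insert a) (Sh F0 \<inter> Sh F1)"
  proof (rule inj_onI)
    fix x y assume "x \<in> Sh F0 \<inter> Sh F1" "y \<in> Sh F0 \<inter> Sh F1" "Set.insert a x = Set.insert a y"
    moreover from this have "a \<notin> x" "a \<notin> y" using insert.hyps by (auto simp: Sh_def)
    ultimately show "x = y" by (metis insert_ident)
  qed
  then have "card (Set.insert a ` (Sh F0 \<inter> Sh F1)) = card (Sh F0 \<inter> Sh F1)" by (rule card_image)
  moreover have "(Sh F0 \<union> Sh F1) \<inter> Set.insert a ` (Sh F0 \<inter> Sh F1) = {}"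
    using insert.hyps unfolding Sh_def by blast
  ultimately have "card (Sh F0 \<union> Sh F1 \<union> Set.insert a ` (Sh F0 \<inter> Sh F1))
      = card (Sh F0 \<union> Sh F1) + card (Sh F0 \<inter> Sh F1)"
    using fin by (simp add: card_Un_disjoint)
  also have "\<dots> = card (Sh F0) + card (Sh F1)"
    using fin card_Un_Int[of "Sh F0" "Sh F1"] by simp
  finally have "card F \<le> card (Sh F0 \<union> Sh F1 \<union> Set.insert a ` (Sh F0 \<inter> Sh F1))"
    using cF le by linarith
  also have "\<dots> \<le> card {I. I \<subseteq> insert a S \<and> shatters F I}"
  proof (rule card_mono[OF _ sub])
    show "finite {I. I \<subseteq> insert a S \<and> shatters F I}"
      by (rule finite_subset[of _ "Pow (insert a S)"]) (use insert.hyps in auto)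
  qed
  finally show ?case .
qed

text \<open>Shattering passes to subsets, so a shattered set with more than \<open>d\<close>
  elements would contain one with exactly \<open>d + 1\<close>. Only sets of size at most
  \<open>d\<close> remain to be counted.\<close>

lemma card_le_sum_binomial_if_not_shatters:
  assumes "finite S" "F \<subseteq> Pow S"
    and no: "\<And>I. I \<subseteq> S \<Longrightarrow> card I = Suc d \<Longrightarrow> \<not> shatters F I"
  shows "card F \<le> (\<Sum>i=0..d. card S choose i)"
proof -
  have "card I \<le> d" if "I \<subseteq> S" "shatters F I" for I
  proof (rule ccontr)
    assume "\<not> card I \<le> d"
    then obtain J where "J \<subseteq> I" "card J = Suc d"
      by (meson not_less_eq_eq obtain_subset_with_card_n)
    then show False using no that shatters_subset by blast
  qed
  then have "{I. I \<subseteq> S \<and> shatters F I} \<subseteq> (\<Union>i\<in>{0..d}. {I. I \<subseteq> S \<and> card I = i})" by auto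
  then have "card {I. I \<subseteq> S \<and> shatters F I} \<le> card (\<Union>i\<in>{0..d}. {I. I \<subseteq> S \<and> card I = i})"
    using assms(1) by (intro card_mono) auto
  also have "\<dots> \<le> (\<Sum>i=0..d. card {I. I \<subseteq> S \<and> card I = i})"
    by (rule card_UN_le) simp
  also have "\<dots> = (\<Sum>i=0..d. card S choose i)"
    using assms(1) by (simp add: n_subsets)
  finally show ?thesis using card_le_card_shattered[OF assms(1,2)] by linarith
qed

section \<open>Small determinants\<close>

text \<open>Laplace expansion along row 0, phrased for an entry function so that rewriting unfolds a
  determinant of small fixed size completely.\<close>

lemma det_mat_Suc:
  fixes f :: "nat \<times> nat \<Rightarrow> 'a::comm_ring_1"
  shows "det (mat (Suc n) (Suc n) f) =
    (\<Sum>j<Suc n. f (0, j) * ((-1) ^ j * det (mat n n (\<lambda>(i, k). f (Suc i, if k < j then k else Suc k)))))"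
proof -
  have "mat_delete (mat (Suc n) (Suc n) f) 0 j = mat n n (\<lambda>(i, k). f (Suc i, if k < j then k else Suc k))"
    if "j < Suc n" for j
    using that by (intro eq_matI) (auto simp: mat_delete_def)
  then show ?thesis
    by (subst laplace_expansion_row[of _ "Suc n" 0]) (auto simp: cofactor_def intro!: sum.cong)
qed

lemma det_mat_0: "det (mat 0 0 f) = (1 :: 'a::comm_ring_1)"
  by (rule det_dim_zero) auto

lemma det_mat_3: "det (mat 3 3 f) = f (0,0) * (f (1,1) * f (2,2) - f (1,2) * f (2,1))
   - f (0,1) * (f (1,0) * f (2,2) - f (1,2) * f (2,0))
   + f (0,2) * (f (1,0) * f (2,1) - f (1,1) * (f (2,0) :: 'a::comm_ring_1))"
  by (simp add: numeral_eq_Suc det_mat_Suc det_mat_0 algebra_simps)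

lemma det_mat_4:
  fixes f :: "nat \<times> nat \<Rightarrow> 'a::comm_ring_1"
  shows "det (mat 4 4 f) = f (0,0) * det (mat 3 3 (\<lambda>(i,k). f (Suc i, Suc k)))
    - f (0,1) * det (mat 3 3 (\<lambda>(i,k). f (Suc i, if k < 1 then k else Suc k)))
    + f (0,2) * det (mat 3 3 (\<lambda>(i,k). f (Suc i, if k < 2 then k else Suc k)))
    - f (0,3) * det (mat 3 3 (\<lambda>(i,k). f (Suc i, if k < 3 then k else Suc k)))"
proof -
  have "{..<Suc 3} = {0,1,2,3::nat}" by auto
  then show ?thesis using det_mat_Suc[of 3 f] by simp
qed

lemma det_mat_5:
  fixes f :: "nat \<times> nat \<Rightarrow> 'a::comm_ring_1"
  shows "det (mat 5 5 f) = f (0,0) * det (mat 4 4 (\<lambda>(i,k). f (Suc i, Suc k)))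
    - f (0,1) * det (mat 4 4 (\<lambda>(i,k). f (Suc i, if k < 1 then k else Suc k)))
    + f (0,2) * det (mat 4 4 (\<lambda>(i,k). f (Suc i, if k < 2 then k else Suc k)))
    - f (0,3) * det (mat 4 4 (\<lambda>(i,k). f (Suc i, if k < 3 then k else Suc k)))
    + f (0,4) * det (mat 4 4 (\<lambda>(i,k). f (Suc i, if k < 4 then k else Suc k)))"
proof -
  have "{..<Suc 4} = {0,1,2,3,4::nat}" by auto
  then show ?thesis using det_mat_Suc[of 4 f] by simp
qed

text \<open>Deleting row and column 0 leaves \<open>h\<close> times J - 2I, with J the all-ones
  matrix of order 4: a Hadamard matrix of determinant -16. Row 0 is free, and the determinant is
  linear in it.\<close>

lemma det_bordered_hadamard:
  fixes f :: "nat \<times> nat \<Rightarrow> real"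
  assumes "\<And>i j. i \<in> {1,2,3,4} \<Longrightarrow> j \<le> 4 \<Longrightarrow> f (i, j) = (if i = j then - h else h)"
  shows "det (mat 5 5 f) = 8 * h ^ 4 * (f (0,1) + f (0,2) + f (0,3) + f (0,4) - 2 * f (0,0))"
proof -
  have v: "f (i, j) = (if i = j then - h else h)"
    if "i \<in> {Suc 0, Suc (Suc 0), Suc (Suc (Suc 0)), Suc (Suc (Suc (Suc 0)))}"
      "j \<le> Suc (Suc (Suc (Suc 0)))" for i j
    using assms[of i j] that by (auto simp: numeral_eq_Suc)
  show ?thesis
    unfolding det_mat_5 det_mat_4 det_mat_3
    by (simp add: numeral_eq_Suc v) (simp add: algebra_simps)
qed

lemma sum_card_fibres: "finite X \<Longrightarrow> card X = (\<Sum>\<tau>\<in>f ` X. card {x\<in>X. f x = \<tau>})"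
  using sum.image_gen[of X "\<lambda>_. 1::nat" f] by simp

lemma card_distinct_list:
  assumes "card W = n" "n > 0"
  obtains xs where "distinct xs" "set xs = W" "length xs = n"
  using finite_distinct_list[of W] assms by (metis card.infinite distinct_card less_irrefl)

lemma card_4E:
  assumes "card W = 4"
  obtains a b c d where "distinct [a,b,c,d]" "W = {a,b,c,d}"
proof -
  obtain xs where xs: "distinct xs" "set xs = W" "length xs = 4"
    using card_distinct_list[OF assms] by auto
  then obtain a b c d where "xs = [a,b,c,d]" by (auto simp: numeral_eq_Suc length_Suc_conv)
  with xs show ?thesis by (intro that[of a b c d]) auto
qed

lemma card_5E:
  assumes "card W = 5"
  obtains a b c d e where "distinct [a,b,c,d,e]" "W = {a,b,c,d,e}"
proof -
  obtain xs where xs: "distinct xs" "set xs = W" "length xs = 5"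
    using card_distinct_list[OF assms] by auto
  then obtain a b c d e where "xs = [a,b,c,d,e]" by (auto simp: numeral_eq_Suc length_Suc_conv)
  with xs show ?thesis by (intro that[of a b c d e]) auto
qed

section \<open>Bounded minors in a residue class\<close>

text \<open>\<open>C\<close> indexes the columns of one residue class, \<open>y r c\<close> is a
  coordinate of column \<open>c\<close> in the chosen basis, and \<open>t\<close> gives the common
  fractional parts. Minors are indexed by lists so that small ones can be instantiated directly;
  repeated columns only add vanishing determinants.\<close>

locale shifted_class =
  fixes R :: "nat set" and C :: "'c set" and y :: "nat \<Rightarrow> 'c \<Rightarrow> real" and t :: "nat \<Rightarrow> real"
  assumes finite_R: "finite R"
    and minor_le_1: "\<And>rs cs. distinct rs \<Longrightarrow> set rs \<subseteq> R \<Longrightarrow> set cs \<subseteq> C \<Longrightarrow> length cs = length rs \<Longrightarrow>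
      \<bar>det (mat (length rs) (length rs) (\<lambda>(a, b). y (rs ! a) (cs ! b)))\<bar> \<le> 1"
    and t_nonneg: "\<And>r. r \<in> R \<Longrightarrow> 0 \<le> t r"
    and t_less_1: "\<And>r. r \<in> R \<Longrightarrow> t r < 1"
    and shift_int: "\<And>r c. r \<in> R \<Longrightarrow> c \<in> C \<Longrightarrow> y r c - t r \<in> \<int>"
    and separated: "\<And>c c'. c \<in> C \<Longrightarrow> c' \<in> C \<Longrightarrow> (\<And>r. r \<in> R \<Longrightarrow> y r c = y r c') \<Longrightarrow> c = c'"
begin

text \<open>Parity determines an entry of a fractional row (\<open>t r \<noteq> 0\<close>), where
  the floor is -1 or 0; in an integral row (\<open>t r = 0\<close>) it forgets only the sign of a
  nonzero entry.\<close>

definition par :: "'c \<Rightarrow> nat set" where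
  "par c = {r\<in>R. odd \<lfloor>y r c\<rfloor>}"

section \<open>Small minors and the shape of the entries\<close>

lemma minor_1:
  assumes "i \<in> R" "a \<in> C"
  shows "\<bar>y i a\<bar> \<le> 1"
  using minor_le_1[of "[i]" "[a]"] assms by (simp add: det_mat_Suc det_mat_0)

lemma minor_2:
  assumes "i \<in> R" "j \<in> R" "i \<noteq> j" "a \<in> C" "b \<in> C"
  shows "\<bar>y i a * y j b - y i b * y j a\<bar> \<le> 1"
  using minor_le_1[of "[i,j]" "[a,b]"] assms by (simp add: det_mat_Suc det_mat_0)

lemma minor_3:
  assumes "i \<in> R" "j \<in> R" "k \<in> R" "i \<noteq> j" "i \<noteq> k" "j \<noteq> k" "a \<in> C" "b \<in> C" "c \<in> C"
  shows "\<bar>y i a * (y j b * y k c - y j c * y k b)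
    - y i b * (y j a * y k c - y j c * y k a) + y i c * (y j a * y k b - y j b * y k a)\<bar> \<le> 1"
proof -
  have "\<bar>det (mat 3 3 (\<lambda>(p, q). y ([i,j,k] ! p) ([a,b,c] ! q)))\<bar> \<le> 1"
    using minor_le_1[of "[i,j,k]" "[a,b,c]"] assms by (simp add: numeral_3_eq_3)
  then show ?thesis by (simp add: det_mat_3)
qed

text \<open>The 1 x 1 minors confine the floor to -1, 0 and 1. In a fractional row the floor 1 would
  push the entry above 1; in an integral row the entry is its own floor.\<close>

lemma y_cases:
  assumes "r \<in> R" "c \<in> C"
  shows y_fractional: "t r \<noteq> 0 \<Longrightarrow> y r c = (if r \<in> par c then t r - 1 else t r)"
    and y_odd: "t r = 0 \<Longrightarrow> r \<in> par c \<Longrightarrow> y r c = 1 \<or> y r c = -1"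
    and y_even: "t r = 0 \<Longrightarrow> r \<notin> par c \<Longrightarrow> y r c = 0"
proof -
  obtain k where k: "y r c = t r + of_int k"
    using shift_int[OF assms] by (metis Ints_cases diff_add_cancel add.commute)
  have le: "\<bar>y r c\<bar> \<le> 1" using minor_1 assms by blast
  have t: "0 \<le> t r" "t r < 1" using t_nonneg t_less_1 assms by auto
  have fl: "\<lfloor>y r c\<rfloor> = k" unfolding k using t by (simp add: floor_eq_iff)
  have k_range: "k = -1 \<or> k = 0 \<or> k = 1"
  proof -
    have "real_of_int k \<le> 1" "real_of_int k > -2" using k le t by linarith+
    then have "k \<le> 1" "k > -2" by linarith+
    then show ?thesis by arith
  qed
  show "y r c = (if r \<in> par c then t r - 1 else t r)" if "t r \<noteq> 0"
    using k_range
  proof (elim disjE)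
    assume "k = 1"
    then show ?thesis using k le t that by simp
  qed (use assms fl k in \<open>auto simp: par_def\<close>)
  show "y r c = 1 \<or> y r c = -1" if "t r = 0" "r \<in> par c"
    using k_range that assms fl k by (auto simp: par_def)
  show "y r c = 0" if "t r = 0" "r \<notin> par c"
    using k_range that assms fl k by (auto simp: par_def)
qed

lemma shattered_column:
  assumes "shatters (par ` C) I"
  shows "\<exists>c\<in>C. \<forall>i\<in>I. i \<in> par c \<longleftrightarrow> P i"
proof -
  have "{i\<in>I. P i} \<subseteq> I" by auto
  then obtain c where "c \<in> C" "par c \<inter> I = {i\<in>I. P i}"
    using assms unfolding shatters_def by (metis (no_types, lifting) image_iff)
  then show ?thesis by (intro bexI[of _ c]) blast+
qed

text \<open>Equal parities mean equal entries in fractional rows and equal supports in integral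
  rows. Opposite signs in a row \<open>i\<close> and equal signs in a row \<open>j\<close> would
  give a 2 x 2 minor of value 2 or -2.\<close>

lemma same_parity_imp_eq_or_neg:
  assumes "c \<in> C" "c' \<in> C" "par c = par c'"
  shows "(\<forall>r\<in>R. y r c' = y r c) \<or> (\<forall>r\<in>R. t r = 0 \<longrightarrow> y r c' = - y r c)"
proof (rule ccontr)
  assume neg: "\<not> ?thesis"
  have frac: "y r c' = y r c" if "r \<in> R" "t r \<noteq> 0" for r
    using y_fractional[OF that(1) _ that(2)] assms by auto
  obtain i where i: "i \<in> R" "y i c' \<noteq> y i c" using neg by auto
  then have ti: "t i = 0" using frac by auto
  obtain j where j: "j \<in> R" "t j = 0" "y j c' \<noteq> - y j c" using neg by auto
  have "i \<in> par c" using y_even i ti assms by metis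
  moreover have "j \<in> par c" using y_even j assms by fastforce
  ultimately have "y i c = 1 \<or> y i c = -1" "y i c' = 1 \<or> y i c' = -1"
     "y j c = 1 \<or> y j c = -1" "y j c' = 1 \<or> y j c' = -1"
    using y_odd i ti j assms by auto
  moreover have "i \<noteq> j" using i j calculation by auto
  ultimately show False using minor_2[OF i(1) j(1) \<open>i \<noteq> j\<close> assms(1,2)] i j by auto
qed

text \<open>Distinct columns of a fibre are opposite on the integral rows. Of three, the second and
  third would both be opposite to the first, hence equal to each other.\<close>

lemma card_parity_fibre_le_2: "card {c\<in>C. par c = P} \<le> 2"
proof (rule ccontr)
  assume "\<not> ?thesis"
  then have "3 \<le> card {c\<in>C. par c = P}" by simp
  then obtain S where "S \<subseteq> {c\<in>C. par c = P}" "card S = 3"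
    by (rule obtain_subset_with_card_n)
  then obtain a b c where S: "{a, b, c} \<subseteq> {c\<in>C. par c = P}" "a \<noteq> b" "a \<noteq> c" "b \<noteq> c"
    unfolding card_3_iff by metis
  then have abc: "a \<in> C" "b \<in> C" "c \<in> C" "par a = P" "par b = P" "par c = P"
    by auto
  have "\<forall>r\<in>R. t r = 0 \<longrightarrow> y r b = - y r a" "\<forall>r\<in>R. t r = 0 \<longrightarrow> y r c = - y r a"
    using same_parity_imp_eq_or_neg[of a b] same_parity_imp_eq_or_neg[of a c]
      separated[of b a] separated[of c a] abc S(2-4) by auto
  then have "y r b = y r c" if "r \<in> R" for r
    using y_fractional[of r b] y_fractional[of r c] abc that by (cases "t r = 0") auto
  then show False using separated[of b c] abc S by auto
qed

text \<open>Such a column is zero. The bound 1 in place of 2 for this fibre makes the constant term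
  of Heller's bound 1 rather than 2.\<close>

lemma card_empty_parity_le_1:
  assumes "\<And>r. r \<in> R \<Longrightarrow> t r = 0"
  shows "card {c\<in>C. par c = {}} \<le> 1"
proof -
  have "c = c'" if "c \<in> {c\<in>C. par c = {}}" "c' \<in> {c\<in>C. par c = {}}" for c c'
    using that assms y_even by (intro separated) auto
  then show ?thesis
    by (cases "finite {c\<in>C. par c = {}}") (simp_all add: card_le_Suc0_iff_eq)
qed

text \<open>Four points of a cube forming a regular tetrahedron, lifted by a constant row.\<close>

lemma tetrahedron:
  assumes "distinct [i0,i1,i2,i3]" "{i0,i1,i2,i3} \<subseteq> R" "{c0,c1,c2,c3} \<subseteq> C"
    and nz: "t i1 \<noteq> 0" "t i2 \<noteq> 0" "t i3 \<noteq> 0"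
    and s: "y i0 c0 = s" "y i0 c1 = s" "y i0 c2 = s" "y i0 c3 = s"
    and p1: "i1 \<in> par c0 \<longleftrightarrow> f" "i1 \<in> par c1 \<longleftrightarrow> f" "i1 \<in> par c2 \<longleftrightarrow> \<not> f" "i1 \<in> par c3 \<longleftrightarrow> \<not> f"
    and p2: "i2 \<notin> par c0" "i2 \<in> par c1" "i2 \<notin> par c2" "i2 \<in> par c3"
    and p3: "i3 \<notin> par c0" "i3 \<in> par c1" "i3 \<in> par c2" "i3 \<notin> par c3"
  shows "\<bar>s\<bar> \<le> 1 / 2"
proof -
  \<comment> \<open>\<open>f\<close> selects one of the two regular tetrahedra in the parity cube of
    \<open>i1\<close>, \<open>i2\<close>, \<open>i3\<close>. The values \<open>p\<close> and
    \<open>q\<close> of row \<open>i1\<close> differ by exactly 1, so the minor below is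
    \<open>2 * s\<close> up to sign.\<close>
  define p q where "p = (if f then t i1 - 1 else t i1)" and "q = (if f then t i1 else t i1 - 1)"
  have v: "y i1 c0 = p" "y i1 c1 = p" "y i1 c2 = q" "y i1 c3 = q"
    "y i2 c0 = t i2" "y i2 c1 = t i2 - 1" "y i2 c2 = t i2" "y i2 c3 = t i2 - 1"
    "y i3 c0 = t i3" "y i3 c1 = t i3 - 1" "y i3 c2 = t i3 - 1" "y i3 c3 = t i3"
    using assms by (auto simp: y_fractional p_def q_def)
  have "\<bar>det (mat 4 4 (\<lambda>(a, b). y ([i0,i1,i2,i3] ! a) ([c0,c1,c2,c3] ! b)))\<bar> \<le> 1"
    using minor_le_1[of "[i0,i1,i2,i3]" "[c0,c1,c2,c3]"] assms(1-3) by (simp add: numeral_eq_Suc)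
  also have "det (mat 4 4 (\<lambda>(a, b). y ([i0,i1,i2,i3] ! a) ([c0,c1,c2,c3] ! b))) = 2 * s * (q - p)"
    by (simp add: numeral_eq_Suc det_mat_Suc det_mat_0 s v) (simp add: algebra_simps)
  finally show ?thesis by (cases f) (simp_all add: p_def q_def)
qed

section \<open>Row sets that cannot be shattered\<close>

lemma shattered_column_nonempty:
  assumes "shatters (insert {} (par ` C)) I" "\<exists>i\<in>I. P i"
  shows "\<exists>c\<in>C. \<forall>i\<in>I. i \<in> par c \<longleftrightarrow> P i"
proof -
  have "{i\<in>I. P i} \<subseteq> I" by auto
  then obtain X where X: "X \<in> insert {} (par ` C)" "X \<inter> I = {i\<in>I. P i}"
    using assms(1) unfolding shatters_def by meson
  then have "X \<noteq> {}" using assms(2) by auto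
  then obtain c where "c \<in> C" "X = par c" using X by auto
  with X show ?thesis by (intro bexI[of _ c]) blast+
qed

text \<open>Compare each column supported on a pair of rows with the one supported on all three: a 2
  x 2 minor that is a difference of two signs must vanish. Hence the two nonzero terms of the
  determinant of \<open>a\<close>, \<open>b\<close>, \<open>c\<close> have product 1 and add up to 2
  or -2. All patterns used are nonempty, so adjoining the empty set to the family does no
  harm.\<close>

lemma not_shatters_3_integral:
  assumes ijk: "distinct [i,j,k]" "{i,j,k} \<subseteq> R" and z: "t i = 0" "t j = 0" "t k = 0"
  shows "\<not> shatters (insert {} (par ` C)) {i,j,k}"
proof
  assume sh: "shatters (insert {} (par ` C)) {i,j,k}"
  obtain a where a: "a \<in> C" "i \<in> par a" "j \<in> par a" "k \<notin> par a"
    using shattered_column_nonempty[OF sh, of "\<lambda>r. r = i \<or> r = j"] ijk by auto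
  obtain b where b: "b \<in> C" "i \<in> par b" "j \<notin> par b" "k \<in> par b"
    using shattered_column_nonempty[OF sh, of "\<lambda>r. r = i \<or> r = k"] ijk by auto
  obtain c where c: "c \<in> C" "i \<notin> par c" "j \<in> par c" "k \<in> par c"
    using shattered_column_nonempty[OF sh, of "\<lambda>r. r = j \<or> r = k"] ijk by auto
  obtain d where d: "d \<in> C" "i \<in> par d" "j \<in> par d" "k \<in> par d"
    using shattered_column_nonempty[OF sh, of "\<lambda>r. True"] ijk by auto
  have R: "i \<in> R" "j \<in> R" "k \<in> R" "i \<noteq> j" "i \<noteq> k" "j \<noteq> k" using ijk by auto
  note zero = y_even[OF R(3) a(1) z(3) a(4)] y_even[OF R(2) b(1) z(2) b(3)] y_even[OF R(1) c(1) z(1) c(2)]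
  have d1: "y i d = 1 \<or> y i d = -1" "y j d = 1 \<or> y j d = -1" "y k d = 1 \<or> y k d = -1"
    using y_odd R d z by auto
  have 1: "y i a = 1 \<or> y i a = -1" "y j a = 1 \<or> y j a = -1" using y_odd R a z by auto
  have 2: "y i b = 1 \<or> y i b = -1" "y k b = 1 \<or> y k b = -1" using y_odd R b z by auto
  have 3: "y j c = 1 \<or> y j c = -1" "y k c = 1 \<or> y k c = -1" using y_odd R c z by auto
  have "y i a * y j a = y i d * y j d"
    using minor_2[OF R(1,2,4) a(1) d(1)] 1 d1 by auto
  moreover have "y i b * y k b = y i d * y k d"
    using minor_2[OF R(1,3,5) b(1) d(1)] 2 d1 by auto
  moreover have "y j c * y k c = y j d * y k d"
    using minor_2[OF R(2,3,6) c(1) d(1)] 3 d1 by auto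
  ultimately have "(y i a * y j a) * (y i b * y k b) * (y j c * y k c)
      = (y i d * y i d) * (y j d * y j d) * (y k d * y k d)"
    by (simp only: ac_simps)
  also have "\<dots> = 1" using d1 by auto
  finally have "(y i a * (y j c * y k b)) * (y i b * (y j a * y k c)) = 1"
    by (simp only: ac_simps)
  moreover have "y i a * (y j c * y k b) = 1 \<or> y i a * (y j c * y k b) = -1"
    using 1 2 3 by auto
  ultimately have "\<bar>y i a * (y j c * y k b) + y i b * (y j a * y k c)\<bar> = 2"
    by auto
  then show False using minor_3[OF R a(1) b(1) c(1)] by (simp add: zero)
qed

text \<open>The 2 x 2 minor on rows \<open>i\<close> and \<open>z\<close> is \<open>s\<close> times
  a difference of two signs; distinct signs would make it exceed 1.\<close>

lemma sign_const:
  assumes "i \<in> R" "z \<in> R" "i \<noteq> z" "a \<in> C" "b \<in> C"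
    and "t z = 0" "z \<in> par a" "z \<in> par b" "y i a = s" "y i b = s" "\<bar>s\<bar> > 1 / 2"
  shows "y z a = y z b"
proof -
  have "y z a = 1 \<or> y z a = -1" "y z b = 1 \<or> y z b = -1" using y_odd assms by auto
  moreover have "\<bar>s * y z b - s * y z a\<bar> \<le> 1" using minor_2[OF assms(1-5)] assms by simp
  ultimately show ?thesis using assms(11) by auto
qed

text \<open>One of the two values of row \<open>q\<close> exceeds 1/2 in absolute value; restricting
  to columns with this value makes the signs in \<open>u\<close> and \<open>v\<close> consistent by
  \<open>sign_const\<close>. Columns supported on \<open>u\<close>, on \<open>v\<close> and on both,
  with entries \<open>t p\<close>, \<open>t p\<close>, \<open>t p - 1\<close> in row
  \<open>p\<close>, then give a minor of absolute value \<open>1 + t p\<close>.\<close>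

lemma not_shatters_2_integral_not_half:
  assumes d: "distinct [u,v,p,q]" "{u,v,p,q} \<subseteq> R" and z: "t u = 0" "t v = 0"
    and nz: "t p \<noteq> 0" "t q \<noteq> 0" "t q \<noteq> 1 / 2"
  shows "\<not> shatters (par ` C) {u,v,p,q}"
proof
  assume sh: "shatters (par ` C) {u,v,p,q}"
  have R: "u \<in> R" "v \<in> R" "p \<in> R" "q \<in> R" and ne: "u \<noteq> v" "u \<noteq> p" "u \<noteq> q" "v \<noteq> p" "v \<noteq> q" "p \<noteq> q"
    using d by auto
  define f where "f \<longleftrightarrow> t q < 1 / 2"
  define s where "s = (if f then t q - 1 else t q)"
  have s: "\<bar>s\<bar> > 1 / 2" using nz by (auto simp: s_def f_def)
  obtain a where a: "a \<in> C" "u \<in> par a" "v \<notin> par a" "p \<notin> par a" "q \<in> par a \<longleftrightarrow> f"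
    using shattered_column[OF sh, of "\<lambda>r. r = u \<or> r = q \<and> f"] ne by auto
  obtain b where b: "b \<in> C" "u \<notin> par b" "v \<in> par b" "p \<notin> par b" "q \<in> par b \<longleftrightarrow> f"
    using shattered_column[OF sh, of "\<lambda>r. r = v \<or> r = q \<and> f"] ne by auto
  obtain c where c: "c \<in> C" "u \<in> par c" "v \<in> par c" "p \<in> par c" "q \<in> par c \<longleftrightarrow> f"
    using shattered_column[OF sh, of "\<lambda>r. r \<noteq> q \<or> f"] ne by auto
  have q: "y q a = s" "y q b = s" "y q c = s"
    using y_fractional[OF R(4) _ nz(2)] a b c by (auto simp: s_def)
  have p: "y p a = t p" "y p b = t p" "y p c = t p - 1"
    using y_fractional[OF R(3) _ nz(1)] a b c by auto
  have "y u a = y u c" using sign_const[OF R(4,1) _ a(1) c(1) z(1) a(2) c(2) q(1,3) s] ne by auto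
  moreover have "y v b = y v c" using sign_const[OF R(4,2) _ b(1) c(1) z(2) b(3) c(3) q(2,3) s] ne by auto
  moreover have "y u c = 1 \<or> y u c = -1" "y v c = 1 \<or> y v c = -1" using y_odd R c z by auto
  moreover have "y v a = 0" "y u b = 0" using y_even R a b z by auto
  moreover have "t p > 0" using t_nonneg[OF R(3)] nz by simp
  ultimately show False using minor_3[OF R(3,1,2) _ _ _ a(1) b(1) c(1)] ne p by auto
qed

lemma not_shatters_2_integral_half:
  assumes d: "distinct [u,v,p,q]" "{u,v,p,q} \<subseteq> R" and z: "t u = 0" "t v = 0"
    and half: "t p = 1 / 2" "t q = 1 / 2"
  shows "\<not> shatters (par ` C) {u,v,p,q}"
proof
  assume sh: "shatters (par ` C) {u,v,p,q}"
  have R: "u \<in> R" "v \<in> R" "p \<in> R" "q \<in> R" and ne: "u \<noteq> v" "u \<noteq> p" "u \<noteq> q" "v \<noteq> p" "v \<noteq> q" "p \<noteq> q"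
    using d by auto
  have "\<exists>c\<in>C. (u \<in> par c \<longleftrightarrow> b1) \<and> (v \<in> par c \<longleftrightarrow> b2) \<and> y p c = 1 / 2 \<and> y q c = (if b3 then - 1 / 2 else 1 / 2)"
    for b1 b2 b3
  proof -
    obtain c where c: "c \<in> C" "u \<in> par c \<longleftrightarrow> b1" "v \<in> par c \<longleftrightarrow> b2" "p \<notin> par c" "q \<in> par c \<longleftrightarrow> b3"
      using shattered_column[OF sh, of "\<lambda>r. r = u \<and> b1 \<or> r = v \<and> b2 \<or> r = q \<and> b3"] ne by auto
    then show ?thesis using y_fractional[OF R(3) c(1)] y_fractional[OF R(4) c(1)] half
      by (intro bexI[of _ c]) auto
  qed
  note col = this
  obtain a where a: "a \<in> C" "u \<in> par a" "v \<notin> par a" "y p a = 1/2" "y q a = 1/2"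
    using col[of True False False] by auto
  obtain a' where a': "a' \<in> C" "u \<in> par a'" "v \<notin> par a'" "y p a' = 1/2" "y q a' = -1/2"
    using col[of True False True] by auto
  obtain b where b: "b \<in> C" "u \<notin> par b" "v \<in> par b" "y p b = 1/2" "y q b = 1/2"
    using col[of False True False] by auto
  obtain b' where b': "b' \<in> C" "u \<notin> par b'" "v \<in> par b'" "y p b' = 1/2" "y q b' = -1/2"
    using col[of False True True] by auto
  obtain c where c: "c \<in> C" "u \<in> par c" "v \<in> par c" "y p c = 1/2" "y q c = 1/2"
    using col[of True True False] by auto
  obtain c' where c': "c' \<in> C" "u \<in> par c'" "v \<in> par c'" "y p c' = 1/2" "y q c' = -1/2"
    using col[of True True True] by auto
  have zero: "y v a = 0" "y v a' = 0" "y u b = 0" "y u b' = 0"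
    using y_even R a a' b b' z by auto
  have pm: "y u a = 1 \<or> y u a = -1" "y u a' = 1 \<or> y u a' = -1"
     "y v b = 1 \<or> y v b = -1" "y v b' = 1 \<or> y v b' = -1"
     "y u c = 1 \<or> y u c = -1" "y u c' = 1 \<or> y u c' = -1"
     "y v c = 1 \<or> y v c = -1" "y v c' = 1 \<or> y v c' = -1"
    using y_odd R a a' b b' c c' z by auto
  have P: "\<bar>- (y p e * (y u g * y v f)) - y p f * (y u e * y v g) + y p g * (y u e * y v f)\<bar> \<le> 1"
    if "e \<in> {a,a'}" "f \<in> {b,b'}" "g \<in> {c,c'}" for e f g
  proof -
    have "y v e = 0" "y u f = 0" "e \<in> C" "f \<in> C" "g \<in> C" using that zero a a' b b' c c' by auto
    then show ?thesis using minor_3[OF R(3,1,2), of e f g] ne by auto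
  qed
  have Q: "\<bar>- (y q e * (y u g * y v f)) - y q f * (y u e * y v g) + y q g * (y u e * y v f)\<bar> \<le> 1"
    if "e \<in> {a,a'}" "f \<in> {b,b'}" "g \<in> {c,c'}" for e f g
  proof -
    have "y v e = 0" "y u f = 0" "e \<in> C" "f \<in> C" "g \<in> C" using that zero a a' b b' c c' by auto
    then show ?thesis using minor_3[OF R(4,1,2), of e f g] ne by auto
  qed
  \<comment> \<open>Both products are signs, so the minor bound forces equality: on rows
    \<open>u\<close> and \<open>v\<close>, column \<open>c'\<close> is \<open>c\<close> or its
    negative.\<close>
  have "y u c * y v c' = y u c' * y v c"
    using minor_2[OF R(1,2) ne(1) c(1) c'(1)] pm(5-8) by auto
  then have k: "y u c' = y u c \<and> y v c' = y v c \<or> y u c' = - y u c \<and> y v c' = - y v c"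
    using pm(5-8) by auto
  \<comment> \<open>Scaling each column by the sign \<open>s\<close> of its entry in row
    \<open>q\<close> makes that row constant, so the condition from \<open>q\<close> has the form of
    the one from \<open>p\<close>, with scaled signs.\<close>
  define s where "s e = 2 * y q e" for e
  have sv: "s a = 1" "s b = 1" "s c = 1" "s a' = -1" "s b' = -1" "s c' = -1"
    using a b c a' b' c' by (simp_all add: s_def)
  have P1: "\<not> (y u g = - y u e \<and> y v g = - y v f)"
    if "e \<in> {a,a'}" "f \<in> {b,b'}" "g \<in> {c,c'}" for e f g
  proof
    assume eq: "y u g = - y u e \<and> y v g = - y v f"
    have *: "y p e = 1/2" "y p f = 1/2" "y p g = 1/2" using that a b c a' b' c' by auto
    have "y u e = 1 \<or> y u e = -1" "y v f = 1 \<or> y v f = -1" using that pm by auto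
    then show False using P[OF that] eq unfolding * by auto
  qed
  have Q1: "\<not> (s g * y u g = - (s e * y u e) \<and> s g * y v g = - (s f * y v f))"
    if "e \<in> {a,a'}" "f \<in> {b,b'}" "g \<in> {c,c'}" for e f g
  proof
    assume eq: "s g * y u g = - (s e * y u e) \<and> s g * y v g = - (s f * y v f)"
    have *: "\<bar>- (s e * (y u g * y v f)) - s f * (y u e * y v g) + s g * (y u e * y v f)\<bar> \<le> 2"
      using Q[OF that] unfolding s_def by linarith
    have "s e = 1 \<or> s e = -1" "s f = 1 \<or> s f = -1" "s g = 1 \<or> s g = -1" using that sv by auto
    moreover have "y u e = 1 \<or> y u e = -1" "y v f = 1 \<or> y v f = -1" using that pm by auto
    ultimately show False using eq *
      by (elim disjE) simp_all
  qed
  note PP = P1[of a b c] P1[of a b c'] P1[of a b' c] P1[of a b' c']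
    P1[of a' b c] P1[of a' b c'] P1[of a' b' c] P1[of a' b' c']
  note QQ = Q1[of a b c] Q1[of a b c'] Q1[of a b' c] Q1[of a b' c']
    Q1[of a' b c] Q1[of a' b c'] Q1[of a' b' c] Q1[of a' b' c']
  note facts = PP[simplified] QQ[unfolded sv, simplified]
  \<comment> \<open>If \<open>c'\<close> agrees with \<open>c\<close>, the conditions from
    \<open>q\<close> make \<open>a\<close>, \<open>a'\<close> opposite in row \<open>u\<close> and
    \<open>b\<close>, \<open>b'\<close> opposite in row \<open>v\<close>, while those from
    \<open>p\<close> make one of these pairs equal. If \<open>c'\<close> is the negative of
    \<open>c\<close>, those from \<open>p\<close> make both pairs equal, while those from
    \<open>q\<close> make one of them opposite.\<close>
  show False
    using pm(1) pm(2) pm(3) pm(4) pm(5) pm(7) k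
    by (elim disjE conjE) (use facts in simp_all)
qed

text \<open>Tetrahedra in rows \<open>j\<close>, \<open>k\<close>, \<open>l\<close> over either
  constant value of row \<open>i\<close> bound both \<open>t i\<close> and \<open>1 - t i\<close> by
  1/2.\<close>

lemma shattered_4_fractional_imp_half:
  assumes d: "distinct [i,j,k,l]" "{i,j,k,l} \<subseteq> R"
    and nz: "t i \<noteq> 0" "t j \<noteq> 0" "t k \<noteq> 0" "t l \<noteq> 0"
    and sh: "shatters (par ` C) {i,j,k,l}"
  shows "t i = 1 / 2"
proof -
  have "\<bar>if f then t i - 1 else t i\<bar> \<le> 1 / 2" for f
  proof -
    obtain c0 where c0: "c0 \<in> C" "i \<in> par c0 \<longleftrightarrow> f" "j \<notin> par c0" "k \<notin> par c0" "l \<notin> par c0"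
      using shattered_column[OF sh, of "\<lambda>r. r = i \<and> f"] d by auto
    obtain c1 where c1: "c1 \<in> C" "i \<in> par c1 \<longleftrightarrow> f" "j \<notin> par c1" "k \<in> par c1" "l \<in> par c1"
      using shattered_column[OF sh, of "\<lambda>r. r = i \<and> f \<or> r = k \<or> r = l"] d by auto
    obtain c2 where c2: "c2 \<in> C" "i \<in> par c2 \<longleftrightarrow> f" "j \<in> par c2" "k \<notin> par c2" "l \<in> par c2"
      using shattered_column[OF sh, of "\<lambda>r. r = i \<and> f \<or> r = j \<or> r = l"] d by auto
    obtain c3 where c3: "c3 \<in> C" "i \<in> par c3 \<longleftrightarrow> f" "j \<in> par c3" "k \<in> par c3" "l \<notin> par c3"
      using shattered_column[OF sh, of "\<lambda>r. r = i \<and> f \<or> r = j \<or> r = k"] d by auto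
    have "i \<in> R" using d by simp
    note v = y_fractional[OF this _ nz(1)]
    show ?thesis
      by (rule tetrahedron[OF d(1,2) _ nz(2-4), of c0 c1 c2 c3 _ False]) (use c0 c1 c2 c3 v in auto)
  qed
  from this[of True] this[of False] show ?thesis by auto
qed

text \<open>The columns with -1/2 in exactly one row form (J - 2I)/2 of order 5, whose determinant
  is 3/2.\<close>

lemma not_shatters_5_half:
  assumes d: "distinct [i,j,k,l,n]" "{i,j,k,l,n} \<subseteq> R"
    and half: "t i = 1 / 2" "t j = 1 / 2" "t k = 1 / 2" "t l = 1 / 2" "t n = 1 / 2"
  shows "\<not> shatters (par ` C) {i,j,k,l,n}"
proof
  assume sh: "shatters (par ` C) {i,j,k,l,n}"
  have "\<exists>c\<in>C. \<forall>r\<in>{i,j,k,l,n}. y r c = (if r = m then -1/2 else 1/2)" for m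
  proof -
    obtain c where c: "c \<in> C" "\<forall>r\<in>{i,j,k,l,n}. r \<in> par c \<longleftrightarrow> r = m"
      using shattered_column[OF sh, of "\<lambda>r. r = m"] by auto
    have "y r c = (if r = m then -1/2 else 1/2)" if "r \<in> {i,j,k,l,n}" for r
    proof -
      have "r \<in> R" "t r = 1/2" "r \<in> par c \<longleftrightarrow> r = m" using that c d half by auto
      then show ?thesis using y_fractional[of r c] c(1) by (cases "r = m") simp_all
    qed
    with c show ?thesis by blast
  qed
  then obtain c where c: "\<And>m. c m \<in> C" "\<And>m. \<forall>r\<in>{i,j,k,l,n}. y r (c m) = (if r = m then -1/2 else 1/2)"
    by metis
  define f where "f = (\<lambda>(a, b). y ([i,j,k,l,n] ! a) ([c i,c j,c k,c l,c n] ! b))"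
  have le: "\<bar>det (mat 5 5 f)\<bar> \<le> 1"
    using minor_le_1[of "[i,j,k,l,n]" "[c i,c j,c k,c l,c n]"] d c(1)
    by (simp add: numeral_eq_Suc f_def)
  have f: "f (a, b) = (if a = b then - (1/2) else 1/2)" if "a \<in> {0,1,2,3,4}" "b \<le> 4" for a b
  proof -
    have "b \<in> {0,1,2,3,4}" using that by auto
    then show ?thesis using d(1) c(2) that(1) by (auto simp: f_def)
  qed
  have "det (mat 5 5 f) = 8 * (1/2) ^ 4 * (f (0,1) + f (0,2) + f (0,3) + f (0,4) - 2 * f (0,0))"
    by (rule det_bordered_hadamard, rule f) auto
  also have "\<dots> = 3 / 2" by (simp add: f power_numeral_reduce)
  finally show False using le by simp
qed

text \<open>Bordering the Hadamard matrix by row \<open>z\<close> and by a column constant on the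
  other rows yields the inequality \<open>key\<close>. Two nonzero entries in row \<open>z\<close>,
  one of them in the constant column, must have equal signs. So the four other entries agree, and
  half their sum is 2 or -2, against \<open>key\<close>.\<close>

lemma not_shatters_4_half_1_integral:
  assumes d: "distinct [z,i,j,k,l]" "{z,i,j,k,l} \<subseteq> R" and z: "t z = 0"
    and half: "t i = 1 / 2" "t j = 1 / 2" "t k = 1 / 2" "t l = 1 / 2"
  shows "\<not> shatters (par ` C) {z,i,j,k,l}"
proof
  assume sh: "shatters (par ` C) {z,i,j,k,l}"
  \<comment> \<open>\<open>m\<close> names the row that carries -1/2, with \<open>m = z\<close>
    standing for none; \<open>f\<close> decides whether the entry in row \<open>z\<close> is
    nonzero.\<close>
  have "\<exists>c\<in>C. (\<forall>r\<in>{i,j,k,l}. y r c = (if r = m then -1/2 else 1/2)) \<and> (if f then y z c = 1 \<or> y z c = -1 else y z c = 0)"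
    for m f
  proof -
    obtain c where c: "c \<in> C" "\<forall>r\<in>{z,i,j,k,l}. r \<in> par c \<longleftrightarrow> (if r = z then f else r = m)"
      by (rule bexE[OF shattered_column[OF sh, of "\<lambda>r. if r = z then f else r = m"]])
    have "y r c = (if r = m then -1/2 else 1/2)" if "r \<in> {i,j,k,l}" for r
    proof -
      have "r \<noteq> z" "r \<in> R" "t r = 1/2" using that d half by auto
      moreover have "r \<in> par c \<longleftrightarrow> r = m"
        using bspec[OF c(2), of r] that \<open>r \<noteq> z\<close> by simp
      ultimately have "r \<in> R" "t r = 1/2" "r \<in> par c \<longleftrightarrow> r = m" by auto
      then show ?thesis using y_fractional[of r c] c(1) by (cases "r = m") simp_all
    qed
    moreover have "if f then y z c = 1 \<or> y z c = -1 else y z c = 0"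
      using y_odd[of z c] y_even[of z c] bspec[OF c(2), of z] c(1) d(2) z by auto
    ultimately show ?thesis using c(1) by blast
  qed
  then obtain c where c: "\<And>m f. c m f \<in> C" "\<And>m f. \<forall>r\<in>{i,j,k,l}. y r (c m f) = (if r = m then -1/2 else 1/2)"
    and cz: "\<And>m f. if f then y z (c m f) = 1 \<or> y z (c m f) = -1 else y z (c m f) = 0"
    by metis
  have c0: "y z (c m False) = 0" for m using cz[of False m] by simp
  have c1: "y z (c m True) = 1 \<or> y z (c m True) = -1" for m using cz[of True m] by simp
  have key: "\<bar>y z (c z f0) - (y z (c i f1) + y z (c j f2) + y z (c k f3) + y z (c l f4)) / 2\<bar> \<le> 1"
    for f0 f1 f2 f3 f4
  proof -
    let ?cs = "[c z f0, c i f1, c j f2, c k f3, c l f4]"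
    define g where "g = (\<lambda>(a, b). y ([z,i,j,k,l] ! a) (?cs ! b))"
    have le: "\<bar>det (mat 5 5 g)\<bar> \<le> 1"
      using minor_le_1[of "[z,i,j,k,l]" ?cs] d c(1) by (simp add: numeral_eq_Suc g_def)
    have g: "g (a, b) = (if a = b then - (1/2) else 1/2)" if "a \<in> {1,2,3,4}" "b \<le> 4" for a b
    proof -
      have "b \<in> {0,1,2,3,4}" using that by auto
      then show ?thesis using d(1) c(2) that(1) by (auto simp: g_def)
    qed
    have "det (mat 5 5 g) = 8 * (1/2) ^ 4 * (g (0,1) + g (0,2) + g (0,3) + g (0,4) - 2 * g (0,0))"
      by (rule det_bordered_hadamard, rule g) auto
    also have "\<dots> = - (y z (c z f0) - (y z (c i f1) + y z (c j f2) + y z (c k f3) + y z (c l f4)) / 2)"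
      by (simp add: g_def power_numeral_reduce)
    finally show ?thesis using le by simp
  qed
  show False
    using c1[of z] c1[of i] c1[of j] c1[of k] c1[of l]
      key[of True True False False False] key[of True False True False False]
      key[of True False False True False] key[of True False False False True]
      key[of False True True True True]
    by (auto simp: c0)
qed

text \<open>In each fractional row, \<open>lo\<close> is the parity whose value exceeds 1/2 in
  absolute value. Columns odd in row \<open>z\<close> with at least one such large entry share their
  sign in row \<open>z\<close>. Four of them forming a tetrahedron contradict
  \<open>tetrahedron\<close>, because row \<open>z\<close> is constantly 1 or -1 there.\<close>

lemma not_shatters_3_fractional_1_integral:
  assumes d: "distinct [z,i,j,k]" "{z,i,j,k} \<subseteq> R" and z: "t z = 0"
    and nz: "t i \<noteq> 0" "t j \<noteq> 0" "t k \<noteq> 0" and nh: "t i \<noteq> 1 / 2" "t j \<noteq> 1 / 2" "t k \<noteq> 1 / 2"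
  shows "\<not> shatters (par ` C) {z,i,j,k}"
proof
  assume sh: "shatters (par ` C) {z,i,j,k}"
  have R: "z \<in> R" "i \<in> R" "j \<in> R" "k \<in> R" and ne: "z \<noteq> i" "z \<noteq> j" "z \<noteq> k" "i \<noteq> j" "i \<noteq> k" "j \<noteq> k"
    using d by auto
  define lo where "lo r \<longleftrightarrow> t r < 1 / 2" for r
  define s where "s r = (if lo r then t r - 1 else t r)" for r
  have s: "\<bar>s r\<bar> > 1 / 2" if "r \<in> {i,j,k}" for r using nh that by (auto simp: s_def lo_def)
  have sv: "y r c = s r" if "r \<in> {i,j,k}" "c \<in> C" "r \<in> par c \<longleftrightarrow> lo r" for r c
    using y_fractional[of r c] that R nz by (auto simp: s_def)
  text \<open>The columns agreeing with \<open>lo\<close> in a fixed fractional row have equal signs in row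
    \<open>z\<close>; the column agreeing in all three rows links the three families.\<close>
  obtain h where h: "h \<in> C" "z \<in> par h" "i \<in> par h \<longleftrightarrow> lo i" "j \<in> par h \<longleftrightarrow> lo j" "k \<in> par h \<longleftrightarrow> lo k"
    using shattered_column[OF sh, of "\<lambda>r. if r = z then True else lo r"] ne by auto
  have link: "y z c = y z h" if "c \<in> C" "z \<in> par c" "r \<in> {i,j,k}" "r \<in> par c \<longleftrightarrow> lo r" for c r
    by (rule sign_const[of r z c h "s r"]) (use that h s sv R ne z in auto)
  have nlo: "\<exists>c\<in>C. z \<in> par c \<and> y z c = y z h \<and> (i \<in> par c \<longleftrightarrow> bi) \<and> (j \<in> par c \<longleftrightarrow> bj) \<and> (k \<in> par c \<longleftrightarrow> bk)"
    if "(bi \<longleftrightarrow> lo i) \<or> (bj \<longleftrightarrow> lo j) \<or> (bk \<longleftrightarrow> lo k)" for bi bj bk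
  proof -
    obtain c where c: "c \<in> C" "z \<in> par c" "i \<in> par c \<longleftrightarrow> bi" "j \<in> par c \<longleftrightarrow> bj" "k \<in> par c \<longleftrightarrow> bk"
      using shattered_column[OF sh, of "\<lambda>r. if r = z then True else if r = i then bi else if r = j then bj else bk"] ne
      by auto
    then have "y z c = y z h" using link[OF c(1,2)] that by auto
    with c show ?thesis by blast
  qed
  have yh: "\<bar>y z h\<bar> = 1" using y_odd[OF R(1) h(1) z h(2)] by auto
  \<comment> \<open>Only the pattern opposite to \<open>lo\<close> in all three rows escapes the
    sign argument. It is a vertex of one of the two tetrahedra, and this \<open>f\<close> selects
    the other.\<close>
  define f where "f \<longleftrightarrow> (lo i \<longleftrightarrow> (lo j \<longleftrightarrow> lo k))"
  obtain c0 where c0: "c0 \<in> C" "z \<in> par c0" "y z c0 = y z h" "i \<in> par c0 \<longleftrightarrow> f" "j \<notin> par c0" "k \<notin> par c0"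
    using nlo[of f False False] unfolding f_def by blast
  obtain c1 where c1: "c1 \<in> C" "z \<in> par c1" "y z c1 = y z h" "i \<in> par c1 \<longleftrightarrow> f" "j \<in> par c1" "k \<in> par c1"
    using nlo[of f True True] unfolding f_def by blast
  obtain c2 where c2: "c2 \<in> C" "z \<in> par c2" "y z c2 = y z h" "i \<in> par c2 \<longleftrightarrow> \<not> f" "j \<notin> par c2" "k \<in> par c2"
    using nlo[of "\<not> f" False True] unfolding f_def by blast
  obtain c3 where c3: "c3 \<in> C" "z \<in> par c3" "y z c3 = y z h" "i \<in> par c3 \<longleftrightarrow> \<not> f" "j \<in> par c3" "k \<notin> par c3"
    using nlo[of "\<not> f" True False] unfolding f_def by blast
  have "\<bar>y z h\<bar> \<le> 1 / 2"
    by (rule tetrahedron[OF d(1,2) _ nz, of c0 c1 c2 c3 _ f]) (use c0 c1 c2 c3 in auto)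
  with yh show False by simp
qed

section \<open>Shattered sets mixing integral and fractional rows\<close>

lemma not_shatters_2_integral:
  assumes d: "distinct [u,v,p,q]" "{u,v,p,q} \<subseteq> R" and z: "t u = 0" "t v = 0"
    and nz: "t p \<noteq> 0" "t q \<noteq> 0"
  shows "\<not> shatters (par ` C) {u,v,p,q}"
proof -
  consider "t q \<noteq> 1/2" | "t p \<noteq> 1/2" | "t p = 1/2" "t q = 1/2" by blast
  then show ?thesis
  proof cases
    case 1
    then show ?thesis using not_shatters_2_integral_not_half[OF d z nz] by blast
  next
    case 2
    have "\<not> shatters (par ` C) {u,v,q,p}"
      by (rule not_shatters_2_integral_not_half) (use d z nz 2 in auto)
    then show ?thesis by (simp add: insert_commute)
  next
    case 3
    then show ?thesis using not_shatters_2_integral_half[OF d z] by blast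
  qed
qed

lemma shattered_fractional_imp_half:
  assumes W: "W \<subseteq> R" "card W \<ge> 4" "\<And>r. r \<in> W \<Longrightarrow> t r \<noteq> 0" and sh: "shatters (par ` C) W" and i: "i \<in> W"
  shows "t i = 1 / 2"
proof -
  have "card (W - {i}) \<ge> 3" using W i by simp
  then obtain J where J: "J \<subseteq> W - {i}" "card J = 3" by (rule obtain_subset_with_card_n)
  then obtain j k l where jkl: "J = {j,k,l}" "j \<noteq> k" "j \<noteq> l" "k \<noteq> l" unfolding card_3_iff by metis
  have "{i,j,k,l} \<subseteq> W" using J jkl i by auto
  then have "shatters (par ` C) {i,j,k,l}" using sh shatters_subset by blast
  then show ?thesis
    using J jkl i W by (intro shattered_4_fractional_imp_half[of i j k l]) auto
qed

lemma not_shatters_3: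
  assumes "I \<subseteq> R" "card I = 3" "\<And>r. r \<in> I \<Longrightarrow> t r = 0"
  shows "\<not> shatters (insert {} (par ` C)) I"
proof -
  obtain i j k where "I = {i,j,k}" "i \<noteq> j" "i \<noteq> k" "j \<noteq> k" using assms unfolding card_3_iff by metis
  then show ?thesis using not_shatters_3_integral[of i j k] assms by auto
qed

lemma shattered_card_integral_le_2:
  assumes "I \<subseteq> R" "shatters (par ` C) I"
  shows "card {i\<in>I. t i = 0} \<le> 2"
proof (rule ccontr)
  assume "\<not> ?thesis"
  then have "3 \<le> card {i\<in>I. t i = 0}" by simp
  then obtain S where S: "S \<subseteq> {i\<in>I. t i = 0}" "card S = 3" by (rule obtain_subset_with_card_n)
  then have "S \<subseteq> I" by auto
  with assms have "shatters (par ` C) S" using shatters_subset by blast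
  then have "shatters (insert {} (par ` C)) S" by (rule shatters_mono) auto
  then show False using not_shatters_3[of S] S assms(1) by auto
qed

lemma shattered_2_integral_imp_fractional_le_1:
  assumes I: "I \<subseteq> R" "shatters (par ` C) I" and Z: "card {i\<in>I. t i = 0} = 2"
  shows "card {i\<in>I. t i \<noteq> 0} \<le> 1"
proof (rule ccontr)
  assume "\<not> ?thesis"
  then have "2 \<le> card {i\<in>I. t i \<noteq> 0}" by simp
  then obtain S where S: "S \<subseteq> {i\<in>I. t i \<noteq> 0}" "card S = 2" by (rule obtain_subset_with_card_n)
  then obtain p q where pq: "S = {p,q}" "p \<noteq> q" unfolding card_2_iff by metis
  obtain u v where uv: "{i\<in>I. t i = 0} = {u,v}" "u \<noteq> v" using Z unfolding card_2_iff by metis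
  have uvI: "u \<in> I" "v \<in> I" "t u = 0" "t v = 0" using uv(1) by blast+
  have pqI: "p \<in> I" "q \<in> I" "t p \<noteq> 0" "t q \<noteq> 0" using S(1) pq(1) by blast+
  have "shatters (par ` C) {u,v,p,q}"
    by (rule shatters_subset[OF I(2)]) (use uvI pqI in auto)
  then show False using not_shatters_2_integral[of u v p q] uv(2) pq(2) uvI pqI I(1) by auto
qed

text \<open>At most two rows are integral, and two of them allow at most one fractional row. So at
  least four rows are fractional, their shifts are all 1/2, and a fifth row of either kind is
  excluded.\<close>

lemma not_shatters_5:
  assumes I: "I \<subseteq> R" "card I = 5"
  shows "\<not> shatters (par ` C) I"
proof
  assume sh: "shatters (par ` C) I"
  define Z where "Z = {i\<in>I. t i = 0}"
  define W where "W = {i\<in>I. t i \<noteq> 0}"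
  have fin: "finite I" using I finite_R finite_subset by blast
  have ZW: "I = Z \<union> W" "Z \<inter> W = {}" "finite Z" "finite W" using fin by (auto simp: Z_def W_def)
  then have card: "card Z + card W = 5" using I(2) card_Un_disjoint by metis
  have "card Z \<le> 2" unfolding Z_def using shattered_card_integral_le_2[OF I(1) sh] .
  moreover have "card Z \<noteq> 2"
    using shattered_2_integral_imp_fractional_le_1[OF I(1) sh] card unfolding Z_def W_def by linarith
  ultimately have Z: "card Z = 0 \<or> card Z = 1" by linarith
  then have "card W \<ge> 4" using card by linarith
  have WR: "W \<subseteq> R" "\<And>r. r \<in> W \<Longrightarrow> t r \<noteq> 0" using I by (auto simp: W_def)
  have "shatters (par ` C) W" by (rule shatters_subset[OF sh]) (simp add: ZW)
  note half = shattered_fractional_imp_half[OF WR(1) \<open>card W \<ge> 4\<close> WR(2) this]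
  from Z show False
  proof
    assume "card Z = 0"
    then have "card W = 5" "I = W" using card ZW by auto
    then obtain i j k l n where *: "distinct [i,j,k,l,n]" "W = {i,j,k,l,n}" using card_5E by blast
    then show False
      using not_shatters_5_half[OF *(1)] WR(1) half sh \<open>I = W\<close> by auto
  next
    assume "card Z = 1"
    then obtain z where z: "Z = {z}" by (auto simp: card_1_singleton_iff)
    have "card W = 4" using card \<open>card Z = 1\<close> by simp
    then obtain i j k l where *: "distinct [i,j,k,l]" "W = {i,j,k,l}" using card_4E by blast
    have "z \<in> I" "t z = 0" "z \<notin> W" using z ZW unfolding Z_def by blast+
    moreover have "I = {z,i,j,k,l}" using ZW(1) z * by auto
    ultimately show False
      using not_shatters_4_half_1_integral[of z i j k l] * half sh I(1) by auto
  qed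
qed

text \<open>Four fractional rows would force shifts 1/2, and two integral rows allow at most one
  fractional row; what remains is one integral row with three fractional ones.\<close>

lemma not_shatters_4:
  assumes I: "I \<subseteq> R" "card I = 4" and nh: "\<And>r. r \<in> R \<Longrightarrow> t r \<noteq> 1 / 2"
  shows "\<not> shatters (par ` C) I"
proof
  assume sh: "shatters (par ` C) I"
  define Z where "Z = {i\<in>I. t i = 0}"
  define W where "W = {i\<in>I. t i \<noteq> 0}"
  have fin: "finite I" using I finite_R finite_subset by blast
  have ZW: "I = Z \<union> W" "Z \<inter> W = {}" "finite Z" "finite W" using fin by (auto simp: Z_def W_def)
  then have card: "card Z + card W = 4" using I(2) card_Un_disjoint by metis
  have "card Z \<le> 2" unfolding Z_def using shattered_card_integral_le_2[OF I(1) sh] .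
  moreover have "card Z \<noteq> 2"
    using shattered_2_integral_imp_fractional_le_1[OF I(1) sh] card unfolding Z_def W_def by linarith
  moreover have WR: "W \<subseteq> R" "\<And>r. r \<in> W \<Longrightarrow> t r \<noteq> 0" using I by (auto simp: W_def)
  moreover have "card Z \<noteq> 0"
  proof
    assume "card Z = 0"
    then have W: "card W \<ge> 4" "I = W" using card ZW by auto
    then obtain i where "i \<in> W" by fastforce
    then show False using shattered_fractional_imp_half[OF WR(1) W(1) WR(2)] sh W(2) WR(1) nh by blast
  qed
  ultimately have "card Z = 1" by linarith
  then obtain z where z: "Z = {z}" by (auto simp: card_1_singleton_iff)
  have "card W = 3" using card \<open>card Z = 1\<close> by simp
  then obtain i j k where *: "W = {i,j,k}" "i \<noteq> j" "i \<noteq> k" "j \<noteq> k" unfolding card_3_iff by metis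
  have "z \<in> I" "t z = 0" "z \<notin> W" using z ZW unfolding Z_def by blast+
  moreover have "I = {z,i,j,k}" using ZW(1) z * by auto
  ultimately show False
    using not_shatters_3_fractional_1_integral[of z i j k] * nh WR sh I(1) by auto
qed

section \<open>Counting the columns of a residue class\<close>

lemma card_le_2_card_parities: "card C \<le> 2 * card (par ` C)"
proof (cases "finite C")
  case True
  have "card C = (\<Sum>P\<in>par ` C. card {c\<in>C. par c = P})"
    using True by (rule sum_card_fibres)
  also have "\<dots> \<le> (\<Sum>P\<in>par ` C. 2)"
    by (intro sum_mono card_parity_fibre_le_2)
  finally show ?thesis by simp
qed simp

lemma parities_subset: "par ` C \<subseteq> Pow R"
  by (auto simp: par_def)

lemma card_class_le: "card C \<le> 2 * (\<Sum>i=0..4. card R choose i)"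
proof -
  have "card (par ` C) \<le> (\<Sum>i=0..4. card R choose i)"
    by (rule card_le_sum_binomial_if_not_shatters[OF finite_R parities_subset])
      (use not_shatters_5 in simp)
  then show ?thesis using card_le_2_card_parities by linarith
qed

lemma card_class_le_no_half:
  assumes "\<And>r. r \<in> R \<Longrightarrow> t r \<noteq> 1 / 2"
  shows "card C \<le> 2 * (\<Sum>i=0..3. card R choose i)"
proof -
  have "card (par ` C) \<le> (\<Sum>i=0..3. card R choose i)"
    by (rule card_le_sum_binomial_if_not_shatters[OF finite_R parities_subset])
      (use not_shatters_4 assms in simp)
  then show ?thesis using card_le_2_card_parities by linarith
qed

lemma card_integral_class_le:
  assumes t0: "\<And>r. r \<in> R \<Longrightarrow> t r = 0"
  shows "card C \<le> (card R)\<^sup>2 + card R + 1"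
proof (cases "finite C")
  case True
  \<comment> \<open>The empty pattern is adjoined whether or not a column realises it: the binomial
    bound still holds, and its fibre contributes at most 1 instead of 2 in either case.\<close>
  define F where "F = insert {} (par ` C)"
  have F: "finite F" "{} \<in> F" using True by (auto simp: F_def)
  have "card F \<le> (\<Sum>i=0..2. card R choose i)"
  proof (rule card_le_sum_binomial_if_not_shatters[OF finite_R])
    show "F \<subseteq> Pow R" using parities_subset by (auto simp: F_def)
    show "\<not> shatters F I" if "I \<subseteq> R" "card I = Suc 2" for I
      unfolding F_def using that t0 by (intro not_shatters_3) auto
  qed
  then have cF: "card F \<le> 1 + card R + (card R choose 2)"
    by (simp add: numeral_2_eq_2)
  have "card C = (\<Sum>P\<in>par ` C. card {c\<in>C. par c = P})"
    using True by (rule sum_card_fibres)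
  also have "\<dots> \<le> (\<Sum>P\<in>F. card {c\<in>C. par c = P})"
    using F by (intro sum_mono2) (auto simp: F_def)
  also have "\<dots> = card {c\<in>C. par c = {}} + (\<Sum>P\<in>F - {{}}. card {c\<in>C. par c = P})"
    using F by (simp add: sum.remove)
  also have "\<dots> \<le> 1 + (\<Sum>P\<in>F - {{}}. 2)"
    by (intro add_mono sum_mono card_parity_fibre_le_2 card_empty_parity_le_1 t0)
  also have "\<dots> = 1 + 2 * (card F - 1)" using F by simp
  also have "\<dots> \<le> 1 + 2 * (card R + (card R choose 2))" using cF by simp
  also have "\<dots> = (card R)\<^sup>2 + card R + 1"
  proof -
    have "even (card R * (card R - 1))" by auto
    then have "2 * (card R choose 2) = card R * (card R - 1)" by (simp add: choose_two)
    then show ?thesis by (cases "card R") (simp_all add: power2_eq_square)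
  qed
  finally show ?thesis .
qed simp

end

section \<open>The index of a sublattice\<close>

definition lattice_cong :: "int mat \<Rightarrow> int vec \<Rightarrow> int vec \<Rightarrow> bool" where
  "lattice_cong B x x' \<longleftrightarrow> (\<exists>z\<in>carrier_vec (dim_col B). x = x' + B *\<^sub>v z)"

lemma lattice_cong_mult_right:
  assumes "lattice_cong (B * E) x x'" "B \<in> carrier_mat m m" "E \<in> carrier_mat m m"
  shows "lattice_cong B x x'"
proof -
  obtain z where z: "z \<in> carrier_vec m" "x = x' + (B * E) *\<^sub>v z"
    using assms unfolding lattice_cong_def by auto
  then have "x = x' + B *\<^sub>v (E *\<^sub>v z)"
    using assms by (metis assoc_mult_mat_vec)
  moreover have "E *\<^sub>v z \<in> carrier_vec m" using assms(3) z(1) by simp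
  ultimately show ?thesis unfolding lattice_cong_def using assms(2) by auto
qed

text \<open>A pigeonhole form of the statement that the lattice spanned by the columns of
  \<open>B\<close> has index at most \<open>\<bar>det B\<bar>\<close>; no quotient group is
  formed.\<close>

definition has_index_bound :: "int mat \<Rightarrow> bool" where
  "has_index_bound B \<longleftrightarrow> (\<forall>S. S \<subseteq> carrier_vec (dim_row B) \<longrightarrow> finite S \<longrightarrow> nat \<bar>det B\<bar> < card S \<longrightarrow>
     (\<exists>x\<in>S. \<exists>x'\<in>S. x \<noteq> x' \<and> lattice_cong B x x'))"

text \<open>The columns of \<open>B * E\<close> span a sublattice of the lattice of
  \<open>B\<close>, so congruence modulo the former implies congruence modulo the latter. This
  carries the bound back along column operations.\<close>

lemma has_index_bound_mult_right:
  assumes "has_index_bound (B * E)" "B \<in> carrier_mat m m" "E \<in> carrier_mat m m"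
    "\<bar>det (B * E)\<bar> = \<bar>det B\<bar>"
  shows "has_index_bound B"
  using assms lattice_cong_mult_right[OF _ assms(2,3)] unfolding has_index_bound_def
  by (metis carrier_matD(1) index_mult_mat(2))

lemma det_first_row:
  fixes B :: "'a::comm_ring_1 mat"
  assumes B: "B \<in> carrier_mat (Suc n) (Suc n)" and zero: "\<And>j. 0 < j \<Longrightarrow> j < Suc n \<Longrightarrow> B $$ (0, j) = 0"
  shows "det B = B $$ (0,0) * det (mat n n (\<lambda>(i, j). B $$ (Suc i, Suc j)))"
proof -
  have "B = mat (Suc n) (Suc n) (\<lambda>ij. B $$ ij)" using B by (intro eq_matI) auto
  then have "det B = det (mat (Suc n) (Suc n) (\<lambda>ij. B $$ ij))" by (rule arg_cong)
  also have "\<dots> = (\<Sum>j<Suc n. B $$ (0, j) * ((-1) ^ j *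
      det (mat n n (\<lambda>(i, k). B $$ (Suc i, if k < j then k else Suc k)))))"
    by (rule det_mat_Suc)
  also have "\<dots> = (\<Sum>j\<in>{0}. B $$ (0, j) * ((-1) ^ j *
      det (mat n n (\<lambda>(i, k). B $$ (Suc i, if k < j then k else Suc k)))))"
    by (rule sum.mono_neutral_right) (use zero in auto)
  finally show ?thesis by simp
qed

lemma pigeonhole_residues:
  fixes f :: "'a \<Rightarrow> int"
  assumes "finite S" "0 < g" "card S > nat g * k"
  obtains r where "card {x\<in>S. f x mod g = r} > k"
proof (rule ccontr)
  assume "\<not> thesis"
  then have le: "card {x\<in>S. f x mod g = r} \<le> k" for r using that not_le_imp_less by blast
  have "S = (\<Union>r\<in>{0..<g}. {x\<in>S. f x mod g = r})"
    using assms(2) by auto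
  then have "card S = card (\<Union>r\<in>{0..<g}. {x\<in>S. f x mod g = r})" by simp
  also have "\<dots> \<le> (\<Sum>r\<in>{0..<g}. card {x\<in>S. f x mod g = r})"
    by (rule card_UN_le) simp
  also have "\<dots> \<le> (\<Sum>r\<in>{0..<g}. k)" by (rule sum_mono) (rule le)
  also have "\<dots> = nat g * k" by simp
  finally show False using assms(3) by simp
qed

text \<open>The first coordinates have at most \<open>\<bar>g\<bar>\<close> residues, so one residue
  occurs for more than \<open>\<bar>det B'\<bar>\<close> vectors. Subtracting multiples of column 0
  gives these a common first coordinate, and the smaller block handles the rest.\<close>

lemma has_index_bound_block:
  assumes B: "B \<in> carrier_mat (Suc n) (Suc n)" and det: "det B \<noteq> 0"
    and zero: "\<And>j. 0 < j \<Longrightarrow> j < Suc n \<Longrightarrow> B $$ (0, j) = 0"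
    and IH: "\<And>B'. B' \<in> carrier_mat n n \<Longrightarrow> det B' \<noteq> 0 \<Longrightarrow> has_index_bound B'"
  shows "has_index_bound B"
  unfolding has_index_bound_def
proof (intro allI impI)
  fix S :: "int vec set" assume S: "S \<subseteq> carrier_vec (dim_row B)" "finite S" "nat \<bar>det B\<bar> < card S"
  define g where "g = B $$ (0,0)"
  define B' where "B' = mat n n (\<lambda>(i, j). B $$ (Suc i, Suc j))"
  have B': "B' \<in> carrier_mat n n" by (simp add: B'_def)
  have detB: "det B = g * det B'"
    unfolding g_def B'_def by (rule det_first_row[OF B zero])
  then have g: "g \<noteq> 0" and "det B' \<noteq> 0" using det by auto
  have "nat \<bar>det B\<bar> = nat \<bar>g\<bar> * nat \<bar>det B'\<bar>"
    by (simp add: detB abs_mult nat_mult_distrib)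
  then obtain r where r: "card {x\<in>S. x $ 0 mod \<bar>g\<bar> = r} > nat \<bar>det B'\<bar>"
    using pigeonhole_residues[of S "\<bar>g\<bar>" "nat \<bar>det B'\<bar>" "\<lambda>x. x $ 0"] S(2,3) g by auto
  define T where "T = {x\<in>S. x $ 0 mod \<bar>g\<bar> = r}"
  \<comment> \<open>The sign turns a multiple of \<open>\<bar>g\<bar>\<close> into a multiple of
    \<open>g\<close> itself.\<close>
  define q where "q x = sgn g * (x $ 0 div \<bar>g\<bar>)" for x :: "int vec"
  have x0: "x $ 0 = g * q x + r" if "x \<in> T" for x
  proof -
    have "x $ 0 = \<bar>g\<bar> * (x $ 0 div \<bar>g\<bar>) + r" using that by (auto simp: T_def)
    then show ?thesis by (simp add: q_def abs_sgn mult.assoc)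
  qed
  \<comment> \<open>This is \<open>x\<close> minus \<open>q x\<close> copies of column 0, with the
    first coordinate dropped; on \<open>T\<close> that coordinate is \<open>r\<close>.\<close>
  define \<phi> where "\<phi> x = vec n (\<lambda>i. x $ Suc i - q x * B $$ (Suc i, 0))" for x :: "int vec"
  have T: "x \<in> carrier_vec (Suc n)" if "x \<in> T" for x using that S(1) B by (auto simp: T_def)
  have lift: "lattice_cong B x x'" if xx': "x \<in> T" "x' \<in> T" "lattice_cong B' (\<phi> x) (\<phi> x')" for x x'
  proof -
    obtain z where z: "z \<in> carrier_vec n" "\<phi> x = \<phi> x' + B' *\<^sub>v z"
      using xx'(3) B' unfolding lattice_cong_def by auto
    define w where "w = vec (Suc n) (\<lambda>j. case j of 0 \<Rightarrow> q x - q x' | Suc k \<Rightarrow> z $ k)"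
    have Bw: "(B *\<^sub>v w) $ i = B $$ (i, 0) * (q x - q x') + (\<Sum>k<n. B $$ (i, Suc k) * z $ k)"
      if "i < Suc n" for i
    proof -
      have "(B *\<^sub>v w) $ i = (\<Sum>j\<in>{0..<Suc n}. B $$ (i, j) * w $ j)"
        using that B by (auto simp: scalar_prod_def w_def intro!: sum.cong)
      also have "\<dots> = B $$ (i, 0) * w $ 0 + (\<Sum>k\<in>{0..<n}. B $$ (i, Suc k) * w $ Suc k)"
        by (subst sum.atLeast0_lessThan_Suc_shift) (simp add: o_def)
      also have "\<dots> = B $$ (i, 0) * (q x - q x') + (\<Sum>k<n. B $$ (i, Suc k) * z $ k)"
        by (simp add: w_def atLeast0LessThan)
      finally show ?thesis .
    qed
    have "x = x' + B *\<^sub>v w"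
    proof (rule eq_vecI)
      show "dim_vec x = dim_vec (x' + B *\<^sub>v w)" using carrier_vecD[OF T[OF xx'(1)]] B by simp
      fix i assume "i < dim_vec (x' + B *\<^sub>v w)"
      then have i: "i < Suc n" using B by simp
      have "x $ i = x' $ i + (B *\<^sub>v w) $ i"
      proof (cases i)
        case 0
        have "(\<Sum>k<n. B $$ (0, Suc k) * z $ k) = 0" using zero by simp
        then show ?thesis using x0[OF xx'(1)] x0[OF xx'(2)] 0 i
          by (simp add: Bw algebra_simps flip: g_def)
      next
        case (Suc l)
        then have l: "l < n" using i by simp
        have "\<phi> x $ l = \<phi> x' $ l + (B' *\<^sub>v z) $ l" using z(2) l B' by simp
        also have "(B' *\<^sub>v z) $ l = (\<Sum>k<n. B $$ (Suc l, Suc k) * z $ k)"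
          using l z(1) by (auto simp: B'_def scalar_prod_def atLeast0LessThan intro!: sum.cong)
        finally show ?thesis using l Suc i
          by (simp add: Bw \<phi>_def algebra_simps)
      qed
      then show "x $ i = (x' + B *\<^sub>v w) $ i" using i B by simp
    qed
    then show ?thesis unfolding lattice_cong_def using B by (auto simp: w_def)
  qed
  \<comment> \<open>If \<phi> identifies two vectors of \<open>T\<close>, their images are congruent
    with coefficient vector 0; otherwise the image is as large as \<open>T\<close> and the induction
    hypothesis applies.\<close>
  have "\<exists>x\<in>T. \<exists>x'\<in>T. x \<noteq> x' \<and> lattice_cong B' (\<phi> x) (\<phi> x')"
  proof (cases "inj_on \<phi> T")
    case True
    then have "nat \<bar>det B'\<bar> < card (\<phi> ` T)" using r by (simp add: T_def card_image)
    moreover have "\<phi> ` T \<subseteq> carrier_vec (dim_row B')" using B' by (auto simp: \<phi>_def)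
    moreover have "finite (\<phi> ` T)" using S(2) by (simp add: T_def)
    ultimately have "\<exists>u\<in>\<phi> ` T. \<exists>v\<in>\<phi> ` T. u \<noteq> v \<and> lattice_cong B' u v"
      using IH[OF B' \<open>det B' \<noteq> 0\<close>] unfolding has_index_bound_def by meson
    then obtain x x' where "x \<in> T" "x' \<in> T" "\<phi> x \<noteq> \<phi> x'" "lattice_cong B' (\<phi> x) (\<phi> x')"
      by auto
    then show ?thesis by (intro bexI[of _ x] bexI[of _ x']) auto
  next
    case False
    then obtain x x' where "x \<in> T" "x' \<in> T" "x \<noteq> x'" "\<phi> x = \<phi> x'" unfolding inj_on_def by auto
    moreover have "lattice_cong B' (\<phi> x') (\<phi> x')"
      unfolding lattice_cong_def
      by (intro bexI[of _ "0\<^sub>v n"] eq_vecI) (use B' in \<open>auto simp: \<phi>_def\<close>)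
    ultimately show ?thesis by metis
  qed
  then obtain x x' where xx: "x \<in> T" "x' \<in> T" "x \<noteq> x'" "lattice_cong B' (\<phi> x) (\<phi> x')" by blast
  have "x \<in> S" "x' \<in> S" using xx by (auto simp: T_def)
  then show "\<exists>x\<in>S. \<exists>x'\<in>S. x \<noteq> x' \<and> lattice_cong B x x'"
    using lift[OF xx(1,2,4)] xx(3) by blast
qed

text \<open>Euclid's algorithm on the first row by column operations reduces to the block case.\<close>

lemma has_index_bound_det:
  assumes "B \<in> carrier_mat m m" "det B \<noteq> 0"
  shows "has_index_bound B"
  using assms
proof (induction m arbitrary: B)
  case 0
  show ?case
    unfolding has_index_bound_def
  proof (intro allI impI)
    fix S :: "int vec set" assume S: "S \<subseteq> carrier_vec (dim_row B)" "finite S" "nat \<bar>det B\<bar> < card S"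
    have "x = 0\<^sub>v 0" if "x \<in> S" for x
    proof -
      have "dim_vec x = 0" using S(1) that 0(1) by (metis carrier_matD(1) carrier_vecD subsetD)
      then show ?thesis by (metis carrier_vecI vec_of_dim_0)
    qed
    then have "S \<subseteq> {0\<^sub>v 0}" by blast
    then have "card S \<le> 1" using card_mono[of "{0\<^sub>v 0 :: int vec}" S] by simp
    moreover have "det B = 1" using 0 by simp
    ultimately show "\<exists>x\<in>S. \<exists>x'\<in>S. x \<noteq> x' \<and> lattice_cong B x x'" using S(3) by simp
  qed
next
  case (Suc n)
  from Suc.prems show ?case
  proof (induction "\<Sum>j<Suc n. nat \<bar>B $$ (0, j)\<bar>" arbitrary: B rule: less_induct)
    case less
    note B = less.prems(1)
    show ?case
    proof (cases "\<exists>k l. k < Suc n \<and> l < Suc n \<and> k \<noteq> l \<and> B $$ (0, k) \<noteq> 0 \<and> B $$ (0, l) \<noteq> 0")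
      case True
      then obtain k l where kl: "k < Suc n" "l < Suc n" "k \<noteq> l" "B $$ (0, k) \<noteq> 0" "B $$ (0, l) \<noteq> 0"
        "\<bar>B $$ (0, l)\<bar> \<le> \<bar>B $$ (0, k)\<bar>"
        by (metis linear)
      \<comment> \<open>With this sign the entry in column \<open>k\<close> shrinks in absolute
        value by that in column \<open>l\<close>, which is nonzero and no larger.\<close>
      define a where "a = - (sgn (B $$ (0, k)) * sgn (B $$ (0, l)))"
      define B1 where "B1 = addcol a k l B"
      have detB1: "det B1 = det B" unfolding B1_def by (rule det_addcol[OF kl(2,3) B])
      have eq: "B1 = B * addrow_mat (Suc n) a l k" unfolding B1_def by (rule addcol_mat[OF B kl(2)])
      have B1: "B1 \<in> carrier_mat (Suc n) (Suc n)"
        unfolding eq by (rule mult_carrier_mat[OF B]) simp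
      have other: "B1 $$ (0, j) = B $$ (0, j)" if "j < Suc n" "j \<noteq> k" for j
        unfolding B1_def using that B by simp
      have "B1 $$ (0, k) = a * B $$ (0, l) + B $$ (0, k)"
        unfolding B1_def using kl B by simp
      then have "\<bar>B1 $$ (0, k)\<bar> < \<bar>B $$ (0, k)\<bar>"
        using kl unfolding a_def by (auto simp: sgn_if abs_if split: if_splits)
      then have "(\<Sum>j<Suc n. nat \<bar>B1 $$ (0, j)\<bar>) < (\<Sum>j<Suc n. nat \<bar>B $$ (0, j)\<bar>)"
      proof (intro sum_strict_mono_ex1 ballI)
        fix j assume "j \<in> {..<Suc n}"
        then show "nat \<bar>B1 $$ (0, j)\<bar> \<le> nat \<bar>B $$ (0, j)\<bar>"
          using other[of j] \<open>\<bar>B1 $$ (0, k)\<bar> < \<bar>B $$ (0, k)\<bar>\<close> by (cases "j = k") auto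
      qed (use kl(1) in \<open>auto intro!: bexI[of _ k]\<close>)
      then have "has_index_bound B1" using less.hyps B1 less.prems(2) detB1 by metis
      then show ?thesis
        using has_index_bound_mult_right[of B "addrow_mat (Suc n) a l k" "Suc n"] B detB1
        by (simp flip: eq)
    next
      case False
      \<comment> \<open>At most one entry of row 0 is nonzero, so at most one column swap leads to
        the block case.\<close>
      have "\<exists>k<Suc n. \<forall>j<Suc n. j \<noteq> k \<longrightarrow> B $$ (0, j) = 0"
        using False by (metis zero_less_Suc)
      then obtain k where k: "k < Suc n" "\<And>j. j < Suc n \<Longrightarrow> j \<noteq> k \<Longrightarrow> B $$ (0, j) = 0" by blast
      show ?thesis
      proof (cases "k = 0")
        case True
        then show ?thesis using has_index_bound_block[OF B less.prems(2) _ Suc.IH] k by auto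
      next
        case False
        define B1 where "B1 = swapcols 0 k B"
        have detB1: "det B1 = - det B" unfolding B1_def
          by (rule det_swapcols) (use k B False in simp_all)
        have eq: "B1 = B * swaprows_mat (Suc n) 0 k"
          unfolding B1_def by (rule swapcols_mat[OF B]) (use k in simp_all)
        have B1: "B1 \<in> carrier_mat (Suc n) (Suc n)"
          unfolding eq by (rule mult_carrier_mat[OF B]) simp
        have "B1 $$ (0, j) = 0" if "0 < j" "j < Suc n" for j
          unfolding B1_def using that B k by auto
        then have "has_index_bound B1"
          using has_index_bound_block[OF B1 _ _ Suc.IH] less.prems(2) detB1 by auto
        then show ?thesis
          using has_index_bound_mult_right[of B "swaprows_mat (Suc n) 0 k" "Suc n"] B detB1
          by (simp flip: eq)
      qed
    qed
  qed
qed

section \<open>Maximal minors and change of basis\<close>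

text \<open>Columns are chosen by a function rather than a set, so that they may be reordered or
  repeated when basis columns are exchanged.\<close>

definition select_cols :: "'a mat \<Rightarrow> (nat \<Rightarrow> nat) \<Rightarrow> 'a mat" where
  "select_cols A g = mat (dim_row A) (dim_row A) (\<lambda>(r, c). A $$ (r, g c))"

lemma select_cols_carrier: "A \<in> carrier_mat m n \<Longrightarrow> select_cols A g \<in> carrier_mat m m"
  by (simp add: select_cols_def)

lemma det_permute_columns:
  fixes M :: "'a::comm_ring_1 mat"
  assumes M: "M \<in> carrier_mat n n" and p: "p permutes {0..<n}"
  shows "det (mat n n (\<lambda>(i, j). M $$ (i, p j))) = signof p * det M"
proof -
  have pj: "p j < n" if "j < n" for j using permutes_in_image[OF p, of j] that by simp
  have "mat n n (\<lambda>(i, j). M $$ (i, p j)) = transpose_mat (mat n n (\<lambda>(i, j). transpose_mat M $$ (p i, j)))"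
    using M pj by (intro eq_matI) auto
  also have "det \<dots> = det (mat n n (\<lambda>(i, j). transpose_mat M $$ (p i, j)))"
    by (rule det_transpose[of _ n]) simp
  also have "\<dots> = signof p * det (transpose_mat M)"
    by (rule det_permute_rows[OF _ p]) (use M in simp)
  also have "det (transpose_mat M) = det M" by (rule det_transpose[OF M])
  finally show ?thesis .
qed

text \<open>Two enumerations of the same columns differ by the permutation \<open>p\<close>, which
  changes at most the sign.\<close>

lemma abs_det_select_cols_reorder:
  fixes A :: "'a::linordered_idom mat"
  assumes A: "A \<in> carrier_mat m n"
    and g: "inj_on g {0..<m}" and h: "inj_on h {0..<m}" and eq: "g ` {0..<m} = h ` {0..<m}"
  shows "\<bar>det (select_cols A g)\<bar> = \<bar>det (select_cols A h)\<bar>"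
proof -
  define p where "p c = (if c < m then inv_into {0..<m} h (g c) else c)" for c
  have gh: "g c \<in> h ` {0..<m}" if "c < m" for c using eq that by auto
  have hp: "h (p c) = g c" "p c < m" if "c < m" for c
    using f_inv_into_f[OF gh[OF that]] inv_into_into[OF gh[OF that]] that by (simp_all add: p_def)
  have "p permutes {0..<m}"
  proof (rule bij_imp_permutes)
    have "inj_on p {0..<m}"
    proof (rule inj_onI)
      fix a b assume ab: "a \<in> {0..<m}" "b \<in> {0..<m}" "p a = p b"
      then have "g a = g b" using hp(1)[of a] hp(1)[of b] by simp
      then show "a = b" using inj_onD[OF g] ab by blast
    qed
    moreover have "p ` {0..<m} \<subseteq> {0..<m}" using hp(2) by auto
    ultimately show "bij_betw p {0..<m} {0..<m}"
      unfolding bij_betw_def using endo_inj_surj by blast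
  qed (simp add: p_def)
  then have "det (mat m m (\<lambda>(i, j). select_cols A h $$ (i, p j))) = signof p * det (select_cols A h)"
    by (rule det_permute_columns[OF select_cols_carrier[OF A]])
  moreover have "mat m m (\<lambda>(i, j). select_cols A h $$ (i, p j)) = select_cols A g"
    using A hp by (intro eq_matI) (auto simp: select_cols_def)
  moreover have "\<bar>signof p :: 'a\<bar> = 1" by (simp add: sign_def)
  ultimately show ?thesis by (simp add: abs_mult)
qed

section \<open>Maximal minors as selections of columns\<close>

lemma submatrix_eq_select_cols:
  assumes A: "A \<in> carrier_mat m n" and J: "J \<subseteq> {..<n}" "card J = m"
  shows "submatrix A {..<m} J = select_cols A (pick J)"
proof -
  have 1: "{i. i < m \<and> i \<in> {..<m}} = {..<m}" by auto
  have 2: "{j. j < n \<and> j \<in> J} = J" using J by auto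
  have pk: "pick {..<m} i = i" if "i < m" for i
  proof -
    have "{a. a < m \<and> a \<in> UNIV} = {..<m}" by auto
    then show ?thesis using pick_reduce_set[of i m UNIV] that by (simp add: pick_UNIV)
  qed
  show ?thesis
    unfolding submatrix_def select_cols_def using A 1 2 J(2) pk by (intro eq_matI) auto
qed

lemma pick_inj_on: "card J = m \<Longrightarrow> inj_on (pick J) {0..<m}"
  unfolding inj_on_def using pick_mono_le[of _ J]
  by (metis atLeastLessThan_iff linorder_neqE_nat order_less_irrefl)

lemma pick_image:
  assumes "finite J" "card J = m"
  shows "pick J ` {0..<m} = J"
proof (rule card_subset_eq[OF assms(1)])
  show "pick J ` {0..<m} \<subseteq> J" using pick_in_set_le[of _ J] assms by auto
  show "card (pick J ` {0..<m}) = card J" using pick_inj_on[OF assms(2)] assms by (simp add: card_image)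
qed

lemma Delta_full:
  fixes A :: "'a::linordered_idom mat"
  assumes A: "A \<in> carrier_mat m n"
  shows "Delta m A = Max {\<bar>det (select_cols A (pick J))\<bar> | J. J \<subseteq> {..<n} \<and> card J = m}"
proof -
  have "I = {..<m}" if "I \<subseteq> {..<m}" "card I = m" for I
    using card_subset_eq[of "{..<m}" I] that by simp
  then have cond: "I \<subseteq> {..<dim_row A} \<and> J \<subseteq> {..<dim_col A} \<and> card I = m \<and> card J = m
     \<longleftrightarrow> I = {..<m} \<and> (J \<subseteq> {..<n} \<and> card J = m)" for I J
    using carrier_matD[OF A] by (metis card_lessThan order_refl)
  have "(\<exists>I J. x = \<bar>det (submatrix A I J)\<bar> \<and> I = {..<m} \<and> J \<subseteq> {..<n} \<and> card J = m)
      \<longleftrightarrow> (\<exists>J. x = \<bar>det (select_cols A (pick J))\<bar> \<and> J \<subseteq> {..<n} \<and> card J = m)" for x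
    using submatrix_eq_select_cols[OF A] by metis
  then show ?thesis unfolding Delta_def cond by simp
qed

lemma finite_select_dets:
  "finite {\<bar>det (select_cols A (pick J))\<bar> | J. J \<subseteq> {..<n} \<and> card J = m}"
proof -
  have "{\<bar>det (select_cols A (pick J))\<bar> | J. J \<subseteq> {..<n} \<and> card J = m}
      \<subseteq> (\<lambda>J. \<bar>det (select_cols A (pick J))\<bar>) ` Pow {..<n}" by auto
  then show ?thesis by (rule finite_subset) simp
qed

text \<open>An injective selection enumerates a column set and differs from \<open>pick\<close> by
  order only; one with a repetition has determinant 0.\<close>

lemma abs_det_select_cols_le_Delta:
  fixes A :: "'a::linordered_idom mat"
  assumes A: "A \<in> carrier_mat m n" and g: "\<And>c. c < m \<Longrightarrow> g c < n" and pos: "Delta m A \<ge> 0"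
  shows "\<bar>det (select_cols A g)\<bar> \<le> Delta m A"
proof (cases "inj_on g {0..<m}")
  case True
  define J where "J = g ` {0..<m}"
  have J: "J \<subseteq> {..<n}" "card J = m" "finite J" using g True by (auto simp: J_def card_image)
  have "\<bar>det (select_cols A g)\<bar> = \<bar>det (select_cols A (pick J))\<bar>"
    by (rule abs_det_select_cols_reorder[OF A True pick_inj_on[OF J(2)]])
      (simp only: pick_image[OF J(3,2)], simp only: J_def)
  also have "\<dots> \<le> Delta m A"
    unfolding Delta_full[OF A] using J by (intro Max_ge finite_select_dets) auto
  finally show ?thesis .
next
  case False
  then obtain i j where ij: "i < m" "j < m" "i \<noteq> j" "g i = g j" by (auto simp: inj_on_def)
  then have "col (select_cols A g) i = col (select_cols A g) j"
    using A by (intro eq_vecI) (auto simp: select_cols_def)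
  then have "det (select_cols A g) = 0"
    using det_identical_columns[OF select_cols_carrier[OF A] ij(3,1,2)] by blast
  then show ?thesis using pos by simp
qed

lemma Delta_attained:
  fixes A :: "'a::linordered_idom mat"
  assumes A: "A \<in> carrier_mat m n" and "m \<le> n"
  obtains f where "inj_on f {0..<m}" "\<And>c. c < m \<Longrightarrow> f c < n" "\<bar>det (select_cols A f)\<bar> = Delta m A"
proof -
  let ?X = "{\<bar>det (select_cols A (pick J))\<bar> | J. J \<subseteq> {..<n} \<and> card J = m}"
  have "{..<m} \<subseteq> {..<n}" "card {..<m} = m" using assms by auto
  then have "?X \<noteq> {}" by blast
  then have "Delta m A \<in> ?X" unfolding Delta_full[OF A] by (rule Max_in[OF finite_select_dets])
  then obtain J where J: "J \<subseteq> {..<n}" "card J = m" "Delta m A = \<bar>det (select_cols A (pick J))\<bar>" by blast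
  have "finite J" using J(1) finite_subset by blast
  then have "pick J c < n" if "c < m" for c
    using pick_image[of J m] J that by (metis atLeastLessThan_iff imageI le0 lessThan_iff subsetD)
  then show ?thesis using that[of "pick J"] pick_inj_on J by simp
qed

section \<open>Coordinates in a basis of largest determinant\<close>

lemma smult_one_mat_mult_vec:
  fixes v :: "'a::comm_ring_1 vec"
  assumes "v \<in> carrier_vec m"
  shows "(d \<cdot>\<^sub>m 1\<^sub>m m) *\<^sub>v v = d \<cdot>\<^sub>v v"
  using assms by (intro eq_vecI) auto

text \<open>\<open>N\<close> divided by \<open>d\<close> holds the coordinates of the columns of
  \<open>A\<close> in the basis \<open>select_cols A f\<close>. Exchanging the basis columns at
  positions \<open>rs\<close> for the columns \<open>cs\<close> multiplies the determinant by the
  minor, up to sign, and maximality bounds the result by \<open>\<bar>d\<bar>\<close>.\<close>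

lemma minor_in_basis_le_1:
  fixes A :: "int mat"
  assumes A: "A \<in> carrier_mat m n"
    and f: "inj_on f {0..<m}" "\<And>c. c < m \<Longrightarrow> f c < n"
    and d: "d = det (select_cols A f)" "d \<noteq> 0" "\<bar>d\<bar> = Delta m A"
    and N: "N = adj_mat (select_cols A f) * A"
    and rs: "distinct rs" "set rs \<subseteq> {..<m}" and cs: "set cs \<subseteq> {..<n}" "length cs = length rs"
  shows "\<bar>det (mat (length rs) (length rs) (\<lambda>(a, b). real_of_int (N $$ (rs ! a, cs ! b)) / real_of_int d))\<bar> \<le> 1"
proof -
  define B where "B = select_cols A f"
  define k where "k = length rs"
  have B: "B \<in> carrier_mat m m" unfolding B_def by (rule select_cols_carrier[OF A])
  have adj: "adj_mat B \<in> carrier_mat m m" "B * adj_mat B = d \<cdot>\<^sub>m 1\<^sub>m m"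
    using adj_mat[OF B] d(1) by (simp_all add: B_def)
  have N': "N \<in> carrier_mat m n" unfolding N B_def[symmetric] by (rule mult_carrier_mat[OF adj(1) A])
  have "B * N = (B * adj_mat B) * A" unfolding N B_def[symmetric]
    using assoc_mult_mat[OF B adj(1) A] by simp
  also have "\<dots> = d \<cdot>\<^sub>m A" unfolding adj(2) using mult_smult_assoc_mat[OF one_carrier_mat A, of d] A by simp
  finally have BN: "B * N = d \<cdot>\<^sub>m A" .
  have sumN: "(\<Sum>s<m. A $$ (r, f s) * N $$ (s, c)) = d * A $$ (r, c)" if "r < m" "c < n" for r c
  proof -
    have "(B * N) $$ (r, c) = (\<Sum>s<m. A $$ (r, f s) * N $$ (s, c))"
      using that B N' A by (auto simp: scalar_prod_def B_def select_cols_def atLeast0LessThan intro!: sum.cong)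
    then show ?thesis unfolding BN using that A by simp
  qed
  \<comment> \<open>Listing the rows of the minor first moves it into the upper left block.\<close>
  define L where "L = rs @ filter (\<lambda>x. x \<notin> set rs) [0..<m]"
  have L: "distinct L" "set L = {0..<m}" using rs by (auto simp: L_def)
  have lenL: "length L = m" using distinct_card[OF L(1)] L(2) by simp
  then have km: "k \<le> m" by (simp add: L_def k_def)
  have Lrs: "L ! a = rs ! a" if "a < k" for a using that by (simp add: L_def nth_append k_def)
  have bijL: "bij_betw ((!) L) {..<m} {..<m}"
    by (rule bij_betw_nth[OF L(1)]) (simp_all only: lenL L(2) atLeast0LessThan)
  have Lm: "L ! c < m" if "c < m" for c using bijL that by (auto simp: bij_betw_def)
  define g where "g c = (if c < k then cs ! c else f (L ! c))" for c
  have csn: "cs ! c < n" if "c < k" for c using that cs nth_mem[of c cs] unfolding k_def by (metis lessThan_iff subsetD)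
  have gn: "g c < n" if "c < m" for c using that csn f(2) Lm by (simp add: g_def)
  define BL where "BL = select_cols A (\<lambda>c. f (L ! c))"
  \<comment> \<open>Coordinates of the exchanged selection in the reordered basis \<open>BL\<close>:
    first the columns \<open>cs\<close>, then unit vectors. The matrix is block lower triangular,
    and its determinant is the minor.\<close>
  define E where "E = mat m m (\<lambda>(r, c). if c < k then real_of_int (N $$ (L ! r, cs ! c)) / real_of_int d
      else if r = c then 1 else 0)"
  define E1 where "E1 = mat k k (\<lambda>(a, b). real_of_int (N $$ (rs ! a, cs ! b)) / real_of_int d)"
  define E3 where "E3 = mat (m - k) k (\<lambda>(a, b). real_of_int (N $$ (L ! (a + k), cs ! b)) / real_of_int d)"
  have "E = four_block_mat E1 (0\<^sub>m k (m - k)) E3 (1\<^sub>m (m - k))"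
    using km Lrs by (intro eq_matI) (auto simp: E_def E1_def E3_def four_block_mat_def)
  then have "det E = det E1 * det (1\<^sub>m (m - k) :: real mat)"
    using det_four_block_mat_upper_right_zero[of E1 k "0\<^sub>m k (m - k)" "m - k" E3 "1\<^sub>m (m - k)"]
    by (simp add: E1_def E3_def)
  then have detE: "det E = det E1" by simp
  have BL: "BL \<in> carrier_mat m m" unfolding BL_def by (rule select_cols_carrier[OF A])
  have entry: "real_of_int (A $$ (r, g c)) = (\<Sum>s<m. real_of_int (A $$ (r, f (L ! s))) * E $$ (s, c))"
    if rc: "r < m" "c < m" for r c
  proof (cases "c < k")
    case True
    have "(\<Sum>s<m. real_of_int (A $$ (r, f (L ! s))) * E $$ (s, c))
        = (\<Sum>s<m. real_of_int (A $$ (r, f (L ! s)) * N $$ (L ! s, cs ! c)) / real_of_int d)"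
      using rc True by (intro sum.cong) (auto simp: E_def)
    also have "\<dots> = (\<Sum>s<m. real_of_int (A $$ (r, f s) * N $$ (s, cs ! c)) / real_of_int d)"
      by (rule sum.reindex_bij_betw[OF bijL])
    also have "\<dots> = real_of_int (\<Sum>s<m. A $$ (r, f s) * N $$ (s, cs ! c)) / real_of_int d"
      by (simp add: sum_divide_distrib)
    also have "\<dots> = real_of_int (A $$ (r, cs ! c))"
      using sumN[OF rc(1) csn[OF True]] d(2) by simp
    finally show ?thesis using True by (simp add: g_def)
  next
    case False
    have "(\<Sum>s<m. real_of_int (A $$ (r, f (L ! s))) * E $$ (s, c))
        = (\<Sum>s<m. if s = c then real_of_int (A $$ (r, f (L ! s))) else 0)"
      using rc False by (intro sum.cong) (auto simp: E_def)
    also have "\<dots> = real_of_int (A $$ (r, f (L ! c)))" using rc by simp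
    finally show ?thesis using False by (simp add: g_def)
  qed
  have "map_mat real_of_int (select_cols A g) = map_mat real_of_int BL * E"
  proof (rule eq_matI)
    fix r c assume "r < dim_row (map_mat real_of_int BL * E)" "c < dim_col (map_mat real_of_int BL * E)"
    then have rc: "r < m" "c < m" using BL by (auto simp: E_def)
    have "(map_mat real_of_int BL * E) $$ (r, c) = (\<Sum>s<m. real_of_int (A $$ (r, f (L ! s))) * E $$ (s, c))"
      using rc A by (auto simp: scalar_prod_def BL_def select_cols_def E_def atLeast0LessThan intro!: sum.cong)
    then show "map_mat real_of_int (select_cols A g) $$ (r, c) = (map_mat real_of_int BL * E) $$ (r, c)"
      using entry[OF rc] rc A by (simp add: select_cols_def)
  qed (use A BL in \<open>auto simp: select_cols_def E_def\<close>)
  then have "det (map_mat real_of_int (select_cols A g)) = det (map_mat real_of_int BL) * det E"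
    using det_mult[of "map_mat real_of_int BL" m E] BL by (simp add: E_def)
  then have eq: "real_of_int (det (select_cols A g)) = real_of_int (det BL) * det E1"
    by (simp add: detE)
  have injfL: "inj_on (\<lambda>c. f (L ! c)) {0..<m}"
    using f(1) bijL by (auto simp: inj_on_def bij_betw_def Lm)
  have imfL: "(\<lambda>c. f (L ! c)) ` {0..<m} = f ` {0..<m}"
    using bijL by (simp add: bij_betw_def atLeast0LessThan flip: image_image)
  have "\<bar>det BL\<bar> = \<bar>d\<bar>"
    unfolding BL_def d(1) by (rule abs_det_select_cols_reorder[OF A injfL f(1) imfL])
  moreover have "\<bar>det (select_cols A g)\<bar> \<le> \<bar>d\<bar>"
    unfolding d(3) by (rule abs_det_select_cols_le_Delta[OF A gn]) (use d(3) in auto)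
  ultimately have "\<bar>real_of_int d\<bar> * \<bar>det E1\<bar> \<le> \<bar>real_of_int d\<bar> * 1"
    using arg_cong[OF eq, of abs] by (simp add: abs_mult flip: of_int_abs)
  then have "\<bar>det E1\<bar> \<le> 1" using d(2) by simp
  then show ?thesis by (simp add: E1_def k_def)
qed

text \<open>\<open>b\<close> bounds a single residue class. The class of 0 gets Heller's bound
  instead, and at most \<open>D - 1\<close> others remain. The integrality of
  \<open>y r c * D\<close>, which is Cramer's rule, is handed on for the case of odd
  \<open>D\<close>.\<close>

lemma card_columns_le:
  fixes A :: "int mat"
  assumes A: "A \<in> carrier_mat m n" and dist: "distinct (cols A)" and D: "Delta m A = D" "D > 0" and m: "m > 0"
    and b: "b \<ge> 0" "\<And>C y t. shifted_class {..<m} C y t \<Longrightarrow> (\<And>r (c :: nat). r < m \<Longrightarrow> c \<in> C \<Longrightarrow> y r c * D \<in> \<int>) \<Longrightarrow>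
      int (card C) \<le> b"
  shows "int n \<le> int (m^2 + m + 1) + (D - 1) * b"
proof (cases "m \<le> n")
  case False
  then have "n \<le> m^2 + m + 1" by linarith
  then have "int n \<le> int (m^2 + m + 1)" by (simp only: of_nat_le_iff)
  also have "\<dots> \<le> int (m^2 + m + 1) + (D - 1) * b" using D b by simp
  finally show ?thesis .
next
  case True
  obtain f where f: "inj_on f {0..<m}" "\<And>c. c < m \<Longrightarrow> f c < n" "\<bar>det (select_cols A f)\<bar> = Delta m A"
    using Delta_attained[OF A True] by blast
  define B where "B = select_cols A f"
  define d where "d = det B"
  define N where "N = adj_mat B * A"
  have d: "\<bar>d\<bar> = D" "d \<noteq> 0" using f(3) D by (auto simp: d_def B_def)
  have B: "B \<in> carrier_mat m m" unfolding B_def by (rule select_cols_carrier[OF A])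
  have adj: "adj_mat B \<in> carrier_mat m m" "B * adj_mat B = d \<cdot>\<^sub>m 1\<^sub>m m" "adj_mat B * B = d \<cdot>\<^sub>m 1\<^sub>m m"
    using adj_mat[OF B] by (simp_all add: d_def)
  have N: "N \<in> carrier_mat m n" unfolding N_def by (rule mult_carrier_mat[OF adj(1) A])
  have colN: "col N c = adj_mat B *\<^sub>v col A c" if "c < n" for c
    unfolding N_def using col_mult2[OF adj(1) A that] .
  have colA: "col A c \<in> carrier_vec m" for c using A by auto
  define y where "y r c = real_of_int (N $$ (r, c)) / real_of_int d" for r c
  \<comment> \<open>The fractional parts of the coordinates identify a residue class; the default 0
    beyond the last row makes equality of these functions a matter of the actual rows.\<close>
  define \<kappa> where "\<kappa> c = (\<lambda>r. if r < m then frac (y r c) else 0)" for c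
  define K where "K \<tau> = {c\<in>{..<n}. \<kappa> c = \<tau>}" for \<tau>
  have cols_inj: "c = c'" if "c < n" "c' < n" "col A c = col A c'" for c c'
    using dist that A by (auto simp: distinct_conv_nth)
  have cls: "shifted_class {..<m} (K \<tau>) y \<tau>" if "\<tau> \<in> \<kappa> ` {..<n}" for \<tau>
  proof
    show "finite {..<m}" by simp
    show "\<bar>det (mat (length rs) (length rs) (\<lambda>(a, b). y (rs ! a) (cs ! b)))\<bar> \<le> 1"
      if "distinct rs" "set rs \<subseteq> {..<m}" "set cs \<subseteq> K \<tau>" "length cs = length rs" for rs cs
      unfolding y_def using that f d D
      by (intro minor_in_basis_le_1[OF A f(1,2), of d N]) (auto simp: d_def N_def B_def K_def)
    show "0 \<le> \<tau> r" "\<tau> r < 1" if "r \<in> {..<m}" for r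
      using \<open>\<tau> \<in> \<kappa> ` {..<n}\<close> that by (auto simp: \<kappa>_def frac_lt_1)
    show "y r c - \<tau> r \<in> \<int>" if "r \<in> {..<m}" "c \<in> K \<tau>" for r c
      using that by (auto simp: K_def \<kappa>_def frac_def)
    show "c = c'" if cc: "c \<in> K \<tau>" "c' \<in> K \<tau>" "\<And>r. r \<in> {..<m} \<Longrightarrow> y r c = y r c'" for c c'
    proof -
      have n: "c < n" "c' < n" using cc by (auto simp: K_def)
      have "N $$ (r, c) = N $$ (r, c')" if "r < m" for r
        using cc(3)[of r] that d(2) by (simp add: y_def)
      then have "col N c = col N c'" using n N by (intro eq_vecI) auto
      then have "B *\<^sub>v (adj_mat B *\<^sub>v col A c) = B *\<^sub>v (adj_mat B *\<^sub>v col A c')"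
        using colN n by simp
      then have "(d \<cdot>\<^sub>m 1\<^sub>m m) *\<^sub>v col A c = (d \<cdot>\<^sub>m 1\<^sub>m m) *\<^sub>v col A c'"
        using assoc_mult_mat_vec[OF B adj(1)] A n unfolding adj(2)[symmetric]
        by (metis carrier_matD(1) col_carrier_vec carrier_matD(2))
      then have "d \<cdot>\<^sub>v col A c = d \<cdot>\<^sub>v col A c'"
        unfolding smult_one_mat_mult_vec[OF colA] .
      then have eq: "(d \<cdot>\<^sub>v col A c) $ i = (d \<cdot>\<^sub>v col A c') $ i" for i by simp
      have "col A c $ i = col A c' $ i" if "i < m" for i using eq[of i] that A d(2) n by simp
      then have "col A c = col A c'" using A by (intro eq_vecI) auto
      then show ?thesis using cols_inj n by blast
    qed
  qed
  let ?T = "\<kappa> ` {..<n}"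
  define \<tau>0 :: "nat \<Rightarrow> real" where "\<tau>0 = (\<lambda>_. 0)"
  \<comment> \<open>A basis column has a unit vector as its coordinates, so the class of 0 is
    nonempty and counts among the at most \<open>D\<close> classes.\<close>
  have "\<kappa> (f 0) = \<tau>0"
  proof
    fix r
    have "N $$ (r, f 0) = (adj_mat B * B) $$ (r, 0)" if "r < m"
      unfolding N_def using that m adj(1) B A f(2)
      by (auto simp: scalar_prod_def B_def select_cols_def intro!: sum.cong)
    then have "r < m \<Longrightarrow> N $$ (r, f 0) = (if r = 0 then d else 0)"
      unfolding adj(3) using m by auto
    then show "\<kappa> (f 0) r = \<tau>0 r" using d(2) by (auto simp: \<kappa>_def y_def \<tau>0_def)
  qed
  then have \<tau>0: "\<tau>0 \<in> ?T" using f(2)[OF m] by (metis imageI lessThan_iff)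
  \<comment> \<open>Among representatives of more than \<open>D\<close> classes, two would be
    congruent modulo the lattice of \<open>B\<close>; their coordinates differ by integers, so their
    classes coincide.\<close>
  have card_T: "card ?T \<le> nat D"
  proof (rule ccontr)
    assume "\<not> card ?T \<le> nat D"
    define \<gamma> where "\<gamma> = inv_into {..<n} \<kappa>"
    have \<gamma>: "\<gamma> \<tau> < n" "\<kappa> (\<gamma> \<tau>) = \<tau>" if "\<tau> \<in> ?T" for \<tau>
      using inv_into_into[OF that] f_inv_into_f[OF that] by (auto simp: \<gamma>_def)
    define S where "S = (\<lambda>\<tau>. col A (\<gamma> \<tau>)) ` ?T"
    have "inj_on (\<lambda>\<tau>. col A (\<gamma> \<tau>)) ?T"
      by (rule inj_onI) (metis \<gamma> cols_inj)
    then have "card S = card ?T" unfolding S_def by (rule card_image)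
    then have "nat \<bar>det B\<bar> < card S" using \<open>\<not> card ?T \<le> nat D\<close> d by (simp add: d_def)
    moreover have "S \<subseteq> carrier_vec (dim_row B)" "finite S" using A B by (auto simp: S_def)
    ultimately have "\<exists>x\<in>S. \<exists>x'\<in>S. x \<noteq> x' \<and> lattice_cong B x x'"
      using has_index_bound_det[OF B] d(2) unfolding d_def has_index_bound_def by meson
    then obtain \<tau> \<tau>' where \<tau>: "\<tau> \<in> ?T" "\<tau>' \<in> ?T" "col A (\<gamma> \<tau>) \<noteq> col A (\<gamma> \<tau>')"
        "lattice_cong B (col A (\<gamma> \<tau>)) (col A (\<gamma> \<tau>'))" unfolding S_def by blast
    then obtain z where z: "z \<in> carrier_vec m" "col A (\<gamma> \<tau>) = col A (\<gamma> \<tau>') + B *\<^sub>v z"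
      unfolding lattice_cong_def using B by auto
    have "col N (\<gamma> \<tau>) = adj_mat B *\<^sub>v (col A (\<gamma> \<tau>') + B *\<^sub>v z)"
      using colN[OF \<gamma>(1)[OF \<tau>(1)]] z(2) by simp
    also have "\<dots> = adj_mat B *\<^sub>v col A (\<gamma> \<tau>') + adj_mat B *\<^sub>v (B *\<^sub>v z)"
      by (rule mult_add_distrib_mat_vec[OF adj(1) colA]) (use B z in simp)
    also have "adj_mat B *\<^sub>v (B *\<^sub>v z) = d \<cdot>\<^sub>v z"
      using assoc_mult_mat_vec[OF adj(1) B z(1)] smult_one_mat_mult_vec[OF z(1)]
      by (simp add: adj(3))
    finally have eq: "col N (\<gamma> \<tau>) = col N (\<gamma> \<tau>') + d \<cdot>\<^sub>v z"
      using colN[OF \<gamma>(1)[OF \<tau>(2)]] by simp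
    have "frac (y r (\<gamma> \<tau>)) = frac (y r (\<gamma> \<tau>'))" if r: "r < m" for r
    proof -
      have "col N (\<gamma> \<tau>) $ r = col N (\<gamma> \<tau>') $ r + d * z $ r" unfolding eq using r z(1) by simp
      then have "N $$ (r, \<gamma> \<tau>) = N $$ (r, \<gamma> \<tau>') + d * z $ r"
        using r N \<gamma>(1)[OF \<tau>(1)] \<gamma>(1)[OF \<tau>(2)] by simp
      then have "y r (\<gamma> \<tau>) = y r (\<gamma> \<tau>') + of_int (z $ r)"
        using d(2) by (simp add: y_def field_simps)
      then show ?thesis by (simp add: frac_def)
    qed
    then have "\<kappa> (\<gamma> \<tau>) = \<kappa> (\<gamma> \<tau>')" by (auto simp: \<kappa>_def)
    then have "\<tau> = \<tau>'" using \<gamma>(2) \<tau> by metis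
    then show False using \<tau>(3) by simp
  qed
  have le_b: "int (card (K \<tau>)) \<le> b" if "\<tau> \<in> ?T" for \<tau>
  proof (rule b(2)[OF cls[OF that]])
    fix r c
    have "y r c * D = of_int (sgn d * N $$ (r, c))"
      using d by (auto simp: y_def sgn_if abs_if split: if_splits)
    then show "y r c * D \<in> \<int>" by (metis Ints_of_int)
  qed
  interpret zero: shifted_class "{..<m}" "K \<tau>0" y \<tau>0 by (rule cls[OF \<tau>0])
  have "card (K \<tau>0) \<le> m^2 + m + 1"
    using zero.card_integral_class_le by (simp add: \<tau>0_def)
  then have le_0: "int (card (K \<tau>0)) \<le> int (m^2 + m + 1)" by linarith
  have "n = card {..<n}" by simp
  also have "\<dots> = (\<Sum>\<tau>\<in>?T. card (K \<tau>))" unfolding K_def by (rule sum_card_fibres) simp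
  finally have n_eq: "n = (\<Sum>\<tau>\<in>?T. card (K \<tau>))" .
  have "int n = (\<Sum>\<tau>\<in>?T. int (card (K \<tau>)))"
    using arg_cong[OF n_eq, of int] by (simp only: of_nat_sum)
  also have "\<dots> = int (card (K \<tau>0)) + (\<Sum>\<tau>\<in>?T - {\<tau>0}. int (card (K \<tau>)))"
    by (rule sum.remove[OF _ \<tau>0]) simp
  also have "\<dots> \<le> int (m^2 + m + 1) + (\<Sum>\<tau>\<in>?T - {\<tau>0}. b)"
    by (intro add_mono le_0 sum_mono le_b) simp
  also have "(\<Sum>\<tau>\<in>?T - {\<tau>0}. b) = int (card ?T - 1) * b" using \<tau>0 by simp
  also have "\<dots> \<le> (D - 1) * b"
    by (rule mult_right_mono) (use card_T b(1) D(2) in linarith)+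
  finally show ?thesis by simp
qed

section \<open>The Heller constant\<close>

text \<open>A shift of 1/2 makes the entry half an odd integer, and an odd multiple of that is never
  an integer.\<close>

lemma (in shifted_class) shift_neq_half:
  assumes "odd D" "r \<in> R" "c \<in> C" "y r c * of_int D \<in> \<int>"
  shows "t r \<noteq> 1 / 2"
proof
  assume half: "t r = 1 / 2"
  obtain k where "y r c - t r = of_int k" using shift_int[OF assms(2,3)] by (rule Ints_cases)
  then have yk: "y r c = (2 * of_int k + 1) / 2" using half by simp
  obtain l where "y r c * of_int D = of_int l" using assms(4) by (rule Ints_cases)
  then have "of_int ((2 * k + 1) * D) = (of_int (2 * l) :: real)" by (simp add: yk)
  then have "(2 * k + 1) * D = 2 * l" by (simp only: of_int_eq_iff)
  then have "even ((2 * k + 1) * D)" by simp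
  then show False using assms(1) by simp
qed

text \<open>The witness is the diagonal matrix with entries \<open>D, 1, ..., 1\<close>; being
  square, it has its determinant as only maximal minor.\<close>

lemma heller_set_nonempty:
  assumes "D > 0" "m > 0"
  shows "heller_set D m \<noteq> {}"
proof -
  define A where "A = mat m m (\<lambda>(i, j). if i = j then if i = 0 then D else 1 else 0)"
  have A: "A \<in> carrier_mat m m" by (simp add: A_def)
  have "det A = prod_list (diag_mat A)"
    by (rule det_upper_triangular[OF _ A]) (auto simp: A_def)
  also have "diag_mat A = map (\<lambda>i. if i = 0 then D else 1) [0..<m]"
    by (auto simp: diag_mat_def A_def)
  also have "prod_list \<dots> = (\<Prod>i\<in>{0..<m}. if i = 0 then D else 1)"
    using prod.distinct_set_conv_list[of "[0..<m]" "\<lambda>i. if i = 0 then D else 1"] by simp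
  also have "\<dots> = D" using assms(2) by simp
  finally have detA: "det A = D" .
  have "J = {..<m}" if "J \<subseteq> {..<m}" "card J = m" for J
    using card_subset_eq[of "{..<m}" J] that by simp
  then have full: "J \<subseteq> {..<m} \<and> card J = m \<longleftrightarrow> J = {..<m}" for J by (metis card_lessThan order_refl)
  have "{\<bar>det (select_cols A (pick J))\<bar> | J. J \<subseteq> {..<m} \<and> card J = m} = {\<bar>det (select_cols A (pick {..<m}))\<bar>}"
    unfolding full by simp
  moreover have "\<bar>det (select_cols A (pick {..<m}))\<bar> = \<bar>det (select_cols A (\<lambda>c. c))\<bar>"
    using pick_image[of "{..<m}" m]
    by (intro abs_det_select_cols_reorder[OF A] pick_inj_on) (auto simp: atLeast0LessThan)
  moreover have "select_cols A (\<lambda>c. c) = A" using A by (auto simp: select_cols_def)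
  ultimately have "Delta m A = D" unfolding Delta_full[OF A] using detA assms(1) by simp
  moreover have "distinct (cols A)"
  proof -
    have "col A i \<noteq> col A j" if "i < m" "j < m" "i \<noteq> j" for i j
    proof
      assume "col A i = col A j"
      then have "col A i $ i = col A j $ i" by simp
      then show False using that assms(1) by (simp add: A_def split: if_splits)
    qed
    then show ?thesis using A by (simp add: distinct_conv_nth)
  qed
  ultimately have "m \<in> heller_set D m" unfolding heller_set_def using A assms(2) by blast
  then show ?thesis by blast
qed

text \<open>A common bound gives finiteness, and with nonemptiness this makes \<open>Max\<close> a
  member of the set.\<close>

lemma heller_le:
  assumes "D > 0" "m > 0" and le: "\<And>n. n \<in> heller_set D m \<Longrightarrow> int n \<le> b"
  shows "finite (heller_set D m) \<and> int (heller D m) \<le> b"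
proof
  show fin: "finite (heller_set D m)"
    by (rule finite_subset[of _ "{..nat b}"]) (use le in force)+
  show "int (heller D m) \<le> b"
    unfolding heller_def by (rule le[OF Max_in[OF fin heller_set_nonempty[OF assms(1,2)]]])
qed

theorem theorem1p2:
  fixes D :: int and m :: nat
  assumes "D > 0" and "m > 0"
  shows "(m \<ge> 5 \<longrightarrow> finite (heller_set D m) \<and>
           int (heller D m) \<le> int (m^2 + m + 1) + 2 * (D - 1) * int (\<Sum>i=0..4. m choose i))
       \<and> (m \<ge> 4 \<and> odd D \<longrightarrow> finite (heller_set D m) \<and>
           int (heller D m) \<le> int (m^2 + m + 1) + 2 * (D - 1) * int (\<Sum>i=0..3. m choose i))"
proof -
  have "int n \<le> int (m^2 + m + 1) + (D - 1) * (2 * int (\<Sum>i=0..4. m choose i))"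
    if n: "n \<in> heller_set D m" for n
  proof -
    obtain A :: "int mat" where A: "A \<in> carrier_mat m n" "distinct (cols A)" "Delta m A = D"
      using n unfolding heller_set_def by blast
    show ?thesis
    proof (rule card_columns_le[OF A assms])
      fix C :: "nat set" and y t assume "shifted_class {..<m} C y t"
      from shifted_class.card_class_le[OF this]
      show "int (card C) \<le> 2 * int (\<Sum>i=0..4. m choose i)" by (simp flip: of_nat_sum)
    qed (simp add: sum_nonneg)
  qed
  then have "finite (heller_set D m) \<and>
      int (heller D m) \<le> int (m^2 + m + 1) + (D - 1) * (2 * int (\<Sum>i=0..4. m choose i))"
    by (rule heller_le[OF assms])
  moreover have "int n \<le> int (m^2 + m + 1) + (D - 1) * (2 * int (\<Sum>i=0..3. m choose i))"
    if n: "n \<in> heller_set D m" and odd: "odd D" for n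
  proof -
    obtain A :: "int mat" where A: "A \<in> carrier_mat m n" "distinct (cols A)" "Delta m A = D"
      using n unfolding heller_set_def by blast
    show ?thesis
    proof (rule card_columns_le[OF A assms])
      fix C :: "nat set" and y t
      assume cls: "shifted_class {..<m} C y t" and int: "\<And>r c. r < m \<Longrightarrow> c \<in> C \<Longrightarrow> y r c * D \<in> \<int>"
      show "int (card C) \<le> 2 * int (\<Sum>i=0..3. m choose i)"
      \<comment> \<open>The shift is tied to \<open>D\<close> only through an entry of some column,
        so the empty class is treated apart.\<close>
      proof (cases "C = {}")
        case False
        then obtain c where "c \<in> C" by blast
        then have "t r \<noteq> 1 / 2" if "r \<in> {..<m}" for r
          using shifted_class.shift_neq_half[OF cls, of D r c] odd int that by simp
        from shifted_class.card_class_le_no_half[OF cls this] show ?thesis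
          by (simp flip: of_nat_sum)
      qed (simp add: sum_nonneg)
    qed (simp add: sum_nonneg)
  qed
  then have "finite (heller_set D m) \<and>
      int (heller D m) \<le> int (m^2 + m + 1) + (D - 1) * (2 * int (\<Sum>i=0..3. m choose i))"
    if "odd D"
    using that by (intro heller_le[OF assms]) simp_all
  ultimately show ?thesis by (simp only: mult.left_commute[of 2] mult.assoc) blast
qed

end
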